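(* Let $\Gamma$ be a finite, simplicial graph. If $\Gamma$ is connected and has at least $3$ vertices, then the right-angled Artin group $A_\Gamma$ belongs to $\mathcal{G}_H$.
   Context: For a finite simplicial graph $\Gamma$ with vertex set $V$, $A_\Gamma$ is the group with generating set $V$ and relations $vw=wv$ whenever $v$ and $w$ are connected by an edge in $\Gamma$. For a finitely generated group $G$ fix a finite symmetric generating set $S$ with word length $\ell_S$, and let $B(n)=\{g\in G:\ell_S(g)\le n\}$. For a finite (discrete) set $A$, $G$ acts on $A^G$ (product topology) by $(gx)_h=x_{g^{-1}h}$. $\mathscr{G}_{inv}$ is the class of Polish groups admitting a compatible bi-invariant metric; for $H\in\mathscr{G}_{inv}$ fix such a (complete) metric $d$. A map $f:A^G\to H$ is H\"older continuous if there are $C>0$, $0<r<1$ such that for every $n\ge0$, $d(f(x),f(y))\le Cr^n$ for all $x,y$ with $x_{B(n)}=y_{B(n)}$. A cocycle $c:G\times A^G\to H$ is a map with $c(gh,x)=c(g,hx)c(h,x)$; it is H\"older continuous if $c(g,\cdot)$ is H\"older continuous for each $g$. Cocycles $c_1,c_2$ are H\"older cohomologous if there is a H\"older continuous $b:A^G\to H$ with $c_1(g,x)=b(gx)^{-1}c_2(g,x)b(x)$ for all $g,x$. $\mathcal{G}_H$ is the class of groups $G$ such that for every finite set $A$ and every $H\in\mathscr{G}_{inv}$, every H\"older continuous cocycle $c:G\times A^G\to H$ is H\"older cohomologous to a group homomorphism $G\to H$. *)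

theory Defs
  imports
    "HOL-Analysis.Analysis"
    "HOL-Algebra.Generated_Groups"
    "Graph_Theory.Pair_Digraph"
    "Graph_Theory.Digraph_Component"
begin

section \<open>Groups given by a presentation, right-angled Artin groups\<close>

text \<open>
  A word is a list of letters: \<open>(v, True)\<close> stands for the generator \<open>v\<close> and \<open>(v, False)\<close> for its
  formal inverse. A relation \<open>l = r\<close> is a pair \<open>(l, r)\<close> of words.
\<close>

type_synonym 'v word = "('v \<times> bool) list"

definition words :: "'v set \<Rightarrow> 'v word set" where
  "words X = lists (X \<times> UNIV)"

inductive_set pres_rel :: "'v set \<Rightarrow> ('v word \<times> 'v word) set \<Rightarrow> ('v word \<times> 'v word) set"
  for X :: "'v set" and R :: "('v word \<times> 'v word) set" where
  refl: "u \<in> words X \<Longrightarrow> (u, u) \<in> pres_rel X R"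
| sym: "(u, w) \<in> pres_rel X R \<Longrightarrow> (w, u) \<in> pres_rel X R"
| trans: "(u, v) \<in> pres_rel X R \<Longrightarrow> (v, w) \<in> pres_rel X R \<Longrightarrow> (u, w) \<in> pres_rel X R"
| cancel: "u \<in> words X \<Longrightarrow> w \<in> words X \<Longrightarrow> v \<in> X \<Longrightarrow>
    (u @ [(v, b), (v, \<not> b)] @ w, u @ w) \<in> pres_rel X R"
| relation: "u \<in> words X \<Longrightarrow> w \<in> words X \<Longrightarrow> (l, r) \<in> R \<Longrightarrow> l \<in> words X \<Longrightarrow> r \<in> words X \<Longrightarrow>
    (u @ l @ w, u @ r @ w) \<in> pres_rel X R"

definition presented_group :: "'v set \<Rightarrow> ('v word \<times> 'v word) set \<Rightarrow> 'v word set monoid" where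
  "presented_group X R =
    \<lparr> carrier = words X // pres_rel X R,
      mult = (\<lambda>P Q. \<Union>p\<in>P. \<Union>q\<in>Q. pres_rel X R `` {p @ q}),
      one = pres_rel X R `` {[]} \<rparr>"

definition raag :: "'v pair_pre_digraph \<Rightarrow> 'v word set monoid" where
  "raag \<Gamma> = presented_group (pverts \<Gamma>)
    {([(v, True), (w, True)], [(w, True), (v, True)]) | v w. (v, w) \<in> parcs \<Gamma>}"

lemma words_simps [simp]:
  "[] \<in> words X"
  "(a # u) \<in> words X \<longleftrightarrow> fst a \<in> X \<and> u \<in> words X"
  "u @ w \<in> words X \<longleftrightarrow> u \<in> words X \<and> w \<in> words X"
  by (cases a; auto simp: words_def)+

lemma pres_rel_words: "(u, w) \<in> pres_rel X R \<Longrightarrow> u \<in> words X \<and> w \<in> words X"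
  by (induction rule: pres_rel.induct) auto

lemma equiv_pres_rel: "equiv (words X) (pres_rel X R)"
proof (rule equivI)
  show "pres_rel X R \<subseteq> words X \<times> words X"
    using pres_rel_words by fastforce
  show "refl_on (words X) (pres_rel X R)"
    using pres_rel_words by (auto intro!: refl_onI pres_rel.refl)
  show "sym (pres_rel X R)"
    by (auto intro!: symI pres_rel.sym)
  show "trans (pres_rel X R)"
    by (auto intro!: transI intro: pres_rel.trans)
qed

lemma pres_rel_append_right:
  assumes "(u, w) \<in> pres_rel X R" "s \<in> words X"
  shows "(u @ s, w @ s) \<in> pres_rel X R"
  using assms
proof (induction rule: pres_rel.induct)
  case (cancel u w v b)
  then show ?case using pres_rel.cancel[of u X "w @ s" v b R] by simp
next
  case (relation u w l r)
  then show ?case using pres_rel.relation[of u X "w @ s" l r R] by simp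
qed (auto intro: pres_rel.refl pres_rel.sym pres_rel.trans)

lemma pres_rel_append_left:
  assumes "(u, w) \<in> pres_rel X R" "s \<in> words X"
  shows "(s @ u, s @ w) \<in> pres_rel X R"
  using assms
proof (induction rule: pres_rel.induct)
  case (cancel u w v b)
  then show ?case using pres_rel.cancel[of "s @ u" X w v b R] by simp
next
  case (relation u w l r)
  then show ?case using pres_rel.relation[of "s @ u" X w l r R] by simp
qed (auto intro: pres_rel.refl pres_rel.sym pres_rel.trans)

lemma pres_rel_append:
  assumes "(u, u') \<in> pres_rel X R" "(w, w') \<in> pres_rel X R"
  shows "(u @ w, u' @ w') \<in> pres_rel X R"
  using pres_rel_append_right[OF assms(1)] pres_rel_append_left[OF assms(2)]
    pres_rel_words[OF assms(1)] pres_rel_words[OF assms(2)] by (meson pres_rel.trans)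

lemma presented_group_mult_class:
  assumes "u \<in> words X" "w \<in> words X"
  shows "(pres_rel X R `` {u}) \<otimes>\<^bsub>presented_group X R\<^esub> (pres_rel X R `` {w})
    = pres_rel X R `` {u @ w}"
proof -
  have "congruent2 (pres_rel X R) (pres_rel X R) (\<lambda>p q. pres_rel X R `` {p @ q})"
    by (rule congruent2I')
      (simp add: equiv_class_eq[OF equiv_pres_rel] pres_rel_append)
  from UN_equiv_class2[OF equiv_pres_rel equiv_pres_rel this assms] show ?thesis
    by (simp add: presented_group_def)
qed

lemma word_inverse:
  assumes "u \<in> words X"
  shows "\<exists>w \<in> words X. (w @ u, []) \<in> pres_rel X R"
  using assms
proof (induction u)
  case Nil
  then show ?case by (auto intro!: bexI[of _ "[]"] pres_rel.refl)
next
  case (Cons a u)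
  obtain v b where a: "a = (v, b)" by (cases a)
  from Cons obtain w where w: "w \<in> words X" "(w @ u, []) \<in> pres_rel X R" by auto
  have "(w @ [(v, \<not> b), (v, \<not> \<not> b)] @ u, w @ u) \<in> pres_rel X R"
    using Cons.prems w a by (intro pres_rel.cancel) auto
  then have "((w @ [(v, \<not> b)]) @ a # u, []) \<in> pres_rel X R"
    using w(2) a by (auto intro: pres_rel.trans)
  moreover have "w @ [(v, \<not> b)] \<in> words X" using w Cons.prems a by simp
  ultimately show ?case by blast
qed

lemma group_presented_group: "group (presented_group X R)"
proof (rule groupI)
  let ?P = "presented_group X R" and ?c = "\<lambda>u. pres_rel X R `` {u}"
  have car: "x \<in> carrier ?P \<longleftrightarrow> (\<exists>u \<in> words X. x = ?c u)" for x
    by (auto simp: presented_group_def quotient_def)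
  have one: "\<one>\<^bsub>?P\<^esub> = ?c []" by (simp add: presented_group_def)
  show "x \<otimes>\<^bsub>?P\<^esub> y \<in> carrier ?P" if "x \<in> carrier ?P" "y \<in> carrier ?P" for x y
    using that unfolding car by (metis presented_group_mult_class words_simps(3))
  show "\<one>\<^bsub>?P\<^esub> \<in> carrier ?P" unfolding car one by (auto intro!: bexI[of _ "[]"])
  show "(x \<otimes>\<^bsub>?P\<^esub> y) \<otimes>\<^bsub>?P\<^esub> z = x \<otimes>\<^bsub>?P\<^esub> (y \<otimes>\<^bsub>?P\<^esub> z)"
    if "x \<in> carrier ?P" "y \<in> carrier ?P" "z \<in> carrier ?P" for x y z
    using that unfolding car by (auto simp: presented_group_mult_class)
  show "\<one>\<^bsub>?P\<^esub> \<otimes>\<^bsub>?P\<^esub> x = x" if "x \<in> carrier ?P" for x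
    using that unfolding car one by (auto simp: presented_group_mult_class)
  show "\<exists>y\<in>carrier ?P. y \<otimes>\<^bsub>?P\<^esub> x = \<one>\<^bsub>?P\<^esub>" if x: "x \<in> carrier ?P" for x
  proof -
    obtain u where u: "u \<in> words X" "x = ?c u" using x car by blast
    obtain w where w: "w \<in> words X" "(w @ u, []) \<in> pres_rel X R"
      using word_inverse[OF u(1)] by blast
    have "?c w \<otimes>\<^bsub>?P\<^esub> x = \<one>\<^bsub>?P\<^esub>"
      using u w by (simp add: one presented_group_mult_class equiv_class_eq[OF equiv_pres_rel])
    then show ?thesis using w car by blast
  qed
qed

section \<open>Word length\<close>

definition symmetric_generating_set :: "('g, 'm) monoid_scheme \<Rightarrow> 'g set \<Rightarrow> bool" where
  "symmetric_generating_set G S \<longleftrightarrow>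
    finite S \<and> S \<subseteq> carrier G \<and> (\<forall>s\<in>S. inv\<^bsub>G\<^esub> s \<in> S) \<and> generate G S = carrier G"

definition word_length :: "('g, 'm) monoid_scheme \<Rightarrow> 'g set \<Rightarrow> 'g \<Rightarrow> nat" where
  "word_length G S g =
    (LEAST n. \<exists>ss. set ss \<subseteq> S \<and> length ss = n \<and> foldr (\<otimes>\<^bsub>G\<^esub>) ss \<one>\<^bsub>G\<^esub> = g)"

definition word_ball :: "('g, 'm) monoid_scheme \<Rightarrow> 'g set \<Rightarrow> nat \<Rightarrow> 'g set" where
  "word_ball G S n = {g \<in> carrier G. word_length G S g \<le> n}"

section \<open>The full shift\<close>

definition full_shift :: "('g, 'm) monoid_scheme \<Rightarrow> 'a set \<Rightarrow> ('g \<Rightarrow> 'a) set" where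
  "full_shift G A = (carrier G \<rightarrow>\<^sub>E A)"

definition shift_action :: "('g, 'm) monoid_scheme \<Rightarrow> 'g \<Rightarrow> ('g \<Rightarrow> 'a) \<Rightarrow> ('g \<Rightarrow> 'a)" where
  "shift_action G g x = (\<lambda>h\<in>carrier G. x (inv\<^bsub>G\<^esub> g \<otimes>\<^bsub>G\<^esub> h))"

section \<open>Polish groups with a bi-invariant metric\<close>

definition polish_group :: "('h, 'm) monoid_scheme \<Rightarrow> 'h topology \<Rightarrow> bool" where
  "polish_group H T \<longleftrightarrow>
    group H \<and> topspace T = carrier H \<and>
    continuous_map (prod_topology T T) T (\<lambda>(x, y). x \<otimes>\<^bsub>H\<^esub> y) \<and>
    continuous_map T T (\<lambda>x. inv\<^bsub>H\<^esub> x) \<and>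
    separable_space T \<and> completely_metrizable_space T"

definition compatible_bi_invariant_metric ::
    "('h, 'm) monoid_scheme \<Rightarrow> 'h topology \<Rightarrow> ('h \<Rightarrow> 'h \<Rightarrow> real) \<Rightarrow> bool" where
  "compatible_bi_invariant_metric H T d \<longleftrightarrow>
    Metric_space (carrier H) d \<and> Metric_space.mtopology (carrier H) d = T \<and>
    (\<forall>g\<in>carrier H. \<forall>x\<in>carrier H. \<forall>y\<in>carrier H.
      d (g \<otimes>\<^bsub>H\<^esub> x) (g \<otimes>\<^bsub>H\<^esub> y) = d x y \<and> d (x \<otimes>\<^bsub>H\<^esub> g) (y \<otimes>\<^bsub>H\<^esub> g) = d x y)"

definition class_G_inv :: "('h, 'm) monoid_scheme \<Rightarrow> 'h topology \<Rightarrow> bool" where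
  "class_G_inv H T \<longleftrightarrow> polish_group H T \<and> (\<exists>d. compatible_bi_invariant_metric H T d)"

section \<open>Hoelder continuous cocycles\<close>

text \<open>
  Hoelder continuity refers to the metric \<open>d\<close> chosen on \<open>H\<close> and to the generating set \<open>S\<close> of \<open>G\<close>.
  It does not depend on \<open>S\<close> (a change of \<open>S\<close> only changes \<open>r\<close>), but it may depend on \<open>d\<close>.
\<close>

definition holder_continuous ::
    "('g, 'm) monoid_scheme \<Rightarrow> 'g set \<Rightarrow> 'a set \<Rightarrow> ('h, 'n) monoid_scheme \<Rightarrow> ('h \<Rightarrow> 'h \<Rightarrow> real) \<Rightarrow>
      (('g \<Rightarrow> 'a) \<Rightarrow> 'h) \<Rightarrow> bool" where
  "holder_continuous G S A H d f \<longleftrightarrow>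
    f \<in> full_shift G A \<rightarrow> carrier H \<and>
    (\<exists>C>0. \<exists>r. 0 < r \<and> r < 1 \<and>
      (\<forall>n. \<forall>x\<in>full_shift G A. \<forall>y\<in>full_shift G A.
        restrict x (word_ball G S n) = restrict y (word_ball G S n) \<longrightarrow> d (f x) (f y) \<le> C * r ^ n))"

definition cocycle ::
    "('g, 'm) monoid_scheme \<Rightarrow> 'a set \<Rightarrow> ('h, 'n) monoid_scheme \<Rightarrow>
      ('g \<Rightarrow> ('g \<Rightarrow> 'a) \<Rightarrow> 'h) \<Rightarrow> bool" where
  "cocycle G A H c \<longleftrightarrow>
    (\<forall>g\<in>carrier G. \<forall>x\<in>full_shift G A. c g x \<in> carrier H) \<and>
    (\<forall>g\<in>carrier G. \<forall>h\<in>carrier G. \<forall>x\<in>full_shift G A.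
      c (g \<otimes>\<^bsub>G\<^esub> h) x = c g (shift_action G h x) \<otimes>\<^bsub>H\<^esub> c h x)"

definition holder_cocycle ::
    "('g, 'm) monoid_scheme \<Rightarrow> 'g set \<Rightarrow> 'a set \<Rightarrow> ('h, 'n) monoid_scheme \<Rightarrow> ('h \<Rightarrow> 'h \<Rightarrow> real) \<Rightarrow>
      ('g \<Rightarrow> ('g \<Rightarrow> 'a) \<Rightarrow> 'h) \<Rightarrow> bool" where
  "holder_cocycle G S A H d c \<longleftrightarrow>
    cocycle G A H c \<and> (\<forall>g\<in>carrier G. holder_continuous G S A H d (c g))"

definition holder_cohomologous ::
    "('g, 'm) monoid_scheme \<Rightarrow> 'g set \<Rightarrow> 'a set \<Rightarrow> ('h, 'n) monoid_scheme \<Rightarrow> ('h \<Rightarrow> 'h \<Rightarrow> real) \<Rightarrow>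
      ('g \<Rightarrow> ('g \<Rightarrow> 'a) \<Rightarrow> 'h) \<Rightarrow> ('g \<Rightarrow> ('g \<Rightarrow> 'a) \<Rightarrow> 'h) \<Rightarrow> bool" where
  "holder_cohomologous G S A H d c\<^sub>1 c\<^sub>2 \<longleftrightarrow>
    (\<exists>b. holder_continuous G S A H d b \<and>
      (\<forall>g\<in>carrier G. \<forall>x\<in>full_shift G A.
        c\<^sub>1 g x = inv\<^bsub>H\<^esub> (b (shift_action G g x)) \<otimes>\<^bsub>H\<^esub> c\<^sub>2 g x \<otimes>\<^bsub>H\<^esub> b x))"

text \<open>
  The alphabets \<open>A\<close> and target groups \<open>H\<close> range over the finite subsets of type \<open>'a\<close> and the groups
  carried by subsets of type \<open>'h\<close>. A definition cannot quantify over types, so these two types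
  are arguments; the class proper is obtained by leaving \<open>'a\<close> and \<open>'h\<close> arbitrary.
  All choices of the generating set \<open>S\<close> and of the complete metric \<open>d\<close> are covered.
\<close>

definition class_G_H :: "'a itself \<Rightarrow> 'h itself \<Rightarrow> ('g, 'm) monoid_scheme \<Rightarrow> bool" where
  "class_G_H TA TH G \<longleftrightarrow>
    group G \<and> (\<exists>S. symmetric_generating_set G S) \<and>
    (\<forall>S (A :: 'a set) (H :: 'h monoid) T d c.
      symmetric_generating_set G S \<and> finite A \<and> class_G_inv H T \<and>
      compatible_bi_invariant_metric H T d \<and> Metric_space.mcomplete (carrier H) d \<and>
      holder_cocycle G S A H d c \<longrightarrow>
      (\<exists>\<phi>\<in>hom G H. holder_cohomologous G S A H d c (\<lambda>g x. \<phi> g)))"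

end

(*
  Let x0 be a constant configuration and phi g = c(g, x0), a homomorphism. For a finitely supported
  x and a generator v, the elements phi(v^n)^-1 c(v^n, x) converge to some b(x): the support of x is
  moved away from 1 at linear speed, because an exponent homomorphism to Z shows v to be undistorted,
  and so the increments decay geometrically by Hoelder continuity and bi-invariance. If v and w are
  adjacent, the flat spanned by v and w shows that v, w and v^-1 give the same limit; by connectedness
  all generators and their inverses do. Taking n + 1 for n gives b(vx) c(v, x) = phi(v) b(x).
  Every k in G stays away from 1 linearly along v^n k or along v^-n k (n >= 0), so passing between
  configurations that agree on B(N) in two steps, one for each ray, costs at most C r^N. So b is
  Hoelder continuous with uniform constants and extends to the whole shift.
*)

theory Submission
  imports Defs "HOL-Algebra.Elementary_Groups"
begin

section \<open>Sequences with geometric increments\<close>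

text \<open>A single ray cannot give uniform constants. Two configurations that differ only at v^-n
  agree on a large ball, yet the ray of v carries their difference through \<one>, and the argument
  then bounds the distance of the two limits only by a constant. For v^-1 the position v^-n is
  harmless, so the two rays together cover every position; this is why the limits along v and v^-1
  have to coincide. No homomorphism to \<int> is 1 on both v and v^-1, so these two are compared
  through a neighbour w, on which the homomorphism can be prescribed independently of v.
  Bi-invariance is needed because nothing controls \<phi>(v^n) and c(v^n, x) as n grows: it cancels
  their common factors in each increment at no cost.\<close>

lemma (in Metric_space) geometric_increments_bound:
  assumes u: "\<And>n. u n \<in> M" and step: "\<And>n. d (u n) (u (Suc n)) \<le> C * r ^ n"
    and r: "0 < r" "r < 1" and C: "0 \<le> C"
  shows "d (u m) (u (m + k)) \<le> C / (1 - r) * r ^ m"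
proof -
  have "d (u m) (u (m + k)) \<le> C * r ^ m * (\<Sum>i<k. r ^ i)"
  proof (induction k)
    case 0
    then show ?case using u by simp
  next
    case (Suc k)
    have "d (u m) (u (m + Suc k)) \<le> d (u m) (u (m + k)) + d (u (m + k)) (u (Suc (m + k)))"
      using triangle u by simp
    also have "\<dots> \<le> C * r ^ m * (\<Sum>i<k. r ^ i) + C * r ^ (m + k)"
      using Suc step by (intro add_mono) auto
    also have "\<dots> = C * r ^ m * (\<Sum>i<Suc k. r ^ i)"
      by (simp add: algebra_simps power_add)
    finally show ?case .
  qed
  also have "\<dots> \<le> C * r ^ m * (1 / (1 - r))"
  proof (intro mult_left_mono)
    show "(\<Sum>i<k. r ^ i) \<le> 1 / (1 - r)"
      using r by (subst sum_gp_strict) (auto simp: divide_right_mono)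
  qed (use C r in auto)
  finally show ?thesis by simp
qed

lemma (in Metric_space) geometric_increments_convergent:
  assumes "mcomplete"
    and u: "\<And>n. u n \<in> M" and step: "\<And>n. d (u n) (u (Suc n)) \<le> C * r ^ n"
    and r: "0 < r" "r < 1" and C: "0 \<le> C"
  obtains l where "l \<in> M" "(\<lambda>n. d (u n) l) \<longlonglongrightarrow> 0"
proof -
  let ?B = "\<lambda>n. 2 * (C / (1 - r) * r ^ n)"
  have bound: "d (u m) (u n) \<le> ?B N" if "N \<le> m" "N \<le> n" for N m n
  proof -
    have "d (u N) (u m) \<le> C / (1 - r) * r ^ N" "d (u N) (u n) \<le> C / (1 - r) * r ^ N"
      using geometric_increments_bound[of u C r N "m - N"]
        geometric_increments_bound[of u C r N "n - N"] that assms by simp_all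
    then show ?thesis using triangle[of "u m" "u N" "u n"] u commute[of "u N" "u m"] by simp
  qed
  have lim: "?B \<longlonglongrightarrow> 0"
    using r by (intro tendsto_mult_right_zero LIMSEQ_realpow_zero) auto
  have "MCauchy u"
    unfolding MCauchy_def
  proof (intro conjI allI impI)
    fix e :: real assume "e > 0"
    then have "eventually (\<lambda>n. ?B n < e) sequentially" using order_tendstoD(2)[OF lim] by blast
    then obtain N where "?B N < e" by (auto simp: eventually_sequentially)
    then show "\<exists>N. \<forall>n n'. N \<le> n \<longrightarrow> N \<le> n' \<longrightarrow> d (u n) (u n') < e"
      using bound by (meson le_less_trans)
  qed (use u in auto)
  then obtain l where "limitin mtopology u l sequentially"
    using \<open>mcomplete\<close> by (auto simp: mcomplete_def)
  then show ?thesis using that by (auto simp: limitin_metric_dist_null)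
qed

section \<open>Word length and homomorphisms to the integers\<close>

locale word_metric = group G for G :: "('g, 'm) monoid_scheme" (structure) +
  fixes S :: "'g set"
  assumes symmetric_generating: "symmetric_generating_set G S"
begin

abbreviation len :: "'g \<Rightarrow> nat" where "len \<equiv> word_length G S"

lemma S_carrier: "s \<in> S \<Longrightarrow> s \<in> carrier G"
  and S_inv: "s \<in> S \<Longrightarrow> inv s \<in> S"
  and finite_S: "finite S"
  and generate_S: "generate G S = carrier G"
  using symmetric_generating by (auto simp: symmetric_generating_set_def)

lemma foldr_mult_closed: "set ss \<subseteq> S \<Longrightarrow> foldr (\<otimes>) ss \<one> \<in> carrier G"
  by (induction ss) (auto simp: S_carrier)

lemma foldr_mult_append:
  "set ss \<subseteq> S \<Longrightarrow> set ts \<subseteq> S \<Longrightarrow>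
    foldr (\<otimes>) (ss @ ts) \<one> = foldr (\<otimes>) ss \<one> \<otimes> foldr (\<otimes>) ts \<one>"
  by (induction ss) (use foldr_mult_closed in \<open>auto simp: S_carrier m_assoc\<close>)

lemma foldr_mult_rev_inv:
  "set ss \<subseteq> S \<Longrightarrow> foldr (\<otimes>) (rev (map (m_inv G) ss)) \<one> = inv (foldr (\<otimes>) ss \<one>)"
proof (induction ss)
  case (Cons s ss)
  have "foldr (\<otimes>) (rev (map (m_inv G) ss) @ [inv s]) \<one>
      = foldr (\<otimes>) (rev (map (m_inv G) ss)) \<one> \<otimes> foldr (\<otimes>) [inv s] \<one>"
    using Cons.prems S_inv by (intro foldr_mult_append) auto
  then show ?case
    using Cons S_carrier foldr_mult_closed[of ss] by (simp add: inv_mult_group)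
qed simp

lemma exists_word: "g \<in> carrier G \<Longrightarrow> \<exists>ss. set ss \<subseteq> S \<and> foldr (\<otimes>) ss \<one> = g"
  unfolding generate_S[symmetric]
proof (induction rule: generate.induct)
  case one
  show ?case by (rule exI[of _ "[]"]) simp
next
  case (incl h)
  then show ?case by (intro exI[of _ "[h]"]) (simp add: S_carrier)
next
  case (inv h)
  then show ?case by (intro exI[of _ "[inv h]"]) (simp add: S_carrier S_inv)
next
  case (eng g h)
  then obtain ss ts where "set ss \<subseteq> S" "foldr (\<otimes>) ss \<one> = g" "set ts \<subseteq> S" "foldr (\<otimes>) ts \<one> = h"
    by blast
  then show ?case using foldr_mult_append[of ss ts] by (intro exI[of _ "ss @ ts"]) simp
qed

lemma geodesic_word:
  assumes "g \<in> carrier G"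
  obtains ss where "set ss \<subseteq> S" "length ss = len g" "foldr (\<otimes>) ss \<one> = g"
proof -
  have "\<exists>n ss. set ss \<subseteq> S \<and> length ss = n \<and> foldr (\<otimes>) ss \<one> = g"
    using exists_word[OF assms] by blast
  then have "\<exists>ss. set ss \<subseteq> S \<and> length ss = len g \<and> foldr (\<otimes>) ss \<one> = g"
    unfolding word_length_def by (rule LeastI_ex)
  then show ?thesis using that by blast
qed

lemma len_le: "set ss \<subseteq> S \<Longrightarrow> foldr (\<otimes>) ss \<one> = g \<Longrightarrow> len g \<le> length ss"
  unfolding word_length_def by (rule Least_le) blast

lemma len_mult:
  assumes "g \<in> carrier G" "h \<in> carrier G"
  shows "len (g \<otimes> h) \<le> len g + len h"
proof -
  obtain ss ts where "set ss \<subseteq> S" "length ss = len g" "foldr (\<otimes>) ss \<one> = g"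
    "set ts \<subseteq> S" "length ts = len h" "foldr (\<otimes>) ts \<one> = h"
    using geodesic_word assms by metis
  then show ?thesis using len_le[of "ss @ ts"] foldr_mult_append[of ss ts] by simp
qed

lemma len_inv_le:
  assumes "g \<in> carrier G"
  shows "len (inv g) \<le> len g"
proof -
  obtain ss where "set ss \<subseteq> S" "length ss = len g" "foldr (\<otimes>) ss \<one> = g"
    using geodesic_word assms by metis
  then show ?thesis
    using len_le[of "rev (map (m_inv G) ss)"] foldr_mult_rev_inv[of ss] S_inv by force
qed

lemma len_inv: "g \<in> carrier G \<Longrightarrow> len (inv g) = len g"
  using len_inv_le[of g] len_inv_le[of "inv g"] by simp

lemma len_one: "len \<one> = 0"
  using len_le[of "[]"] by simp

lemma len_pow: "g \<in> carrier G \<Longrightarrow> len (g [^] (n::nat)) \<le> n * len g"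
proof (induction n)
  case (Suc n)
  then show ?case using len_mult[of "g [^] n" g] by simp
qed (simp add: len_one)

lemma finite_word_ball: "finite {k \<in> carrier G. len k \<le> n}"
proof (rule finite_subset)
  show "{k \<in> carrier G. len k \<le> n} \<subseteq> (\<lambda>ss. foldr (\<otimes>) ss \<one>) ` {ss. set ss \<subseteq> S \<and> length ss \<le> n}"
    using geodesic_word by (smt (verit) image_eqI mem_Collect_eq subsetI)
  show "finite ((\<lambda>ss. foldr (\<otimes>) ss \<one>) ` {ss. set ss \<subseteq> S \<and> length ss \<le> n})"
    using finite_lists_length_le[OF finite_S] by (rule finite_imageI)
qed

section \<open>Homomorphisms to \<int> and lower bounds for the word length\<close>

lemma int_hom_mult:
  "\<xi> \<in> hom G integer_group \<Longrightarrow> g \<in> carrier G \<Longrightarrow> h \<in> carrier G \<Longrightarrow> \<xi> (g \<otimes> h) = \<xi> g + \<xi> h"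
  by (simp add: hom_mult)

lemma int_hom_one: "\<xi> \<in> hom G integer_group \<Longrightarrow> \<xi> \<one> = 0"
  using int_hom_mult[of \<xi> \<one> \<one>] by simp

lemma int_hom_pow:
  "\<xi> \<in> hom G integer_group \<Longrightarrow> g \<in> carrier G \<Longrightarrow> \<xi> (g [^] (n::nat)) = int n * \<xi> g"
  by (induction n) (simp_all add: int_hom_one int_hom_mult algebra_simps)

text \<open>Read backwards: an element on which \<xi> is large is far from \<one>.
  \<open>ray_away\<close> and \<open>decay\<close> draw their linear lower bounds on
  \<open>len\<close> from this.\<close>

lemma int_hom_lipschitz:
  assumes \<xi>: "\<xi> \<in> hom G integer_group"
  obtains K :: nat where "0 < K" "\<And>g. g \<in> carrier G \<Longrightarrow> \<bar>\<xi> g\<bar> \<le> int K * int (len g)"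
proof -
  \<comment> \<open>\<open>Suc\<close> keeps \<open>K\<close> positive even if \<xi> vanishes on
    \<open>S\<close>; later \<open>K\<close> is the index of a root.\<close>
  define K where "K = Suc (\<Sum>s\<in>S. nat \<bar>\<xi> s\<bar>)"
  have K: "\<bar>\<xi> s\<bar> \<le> int K" if "s \<in> S" for s
  proof -
    have "nat \<bar>\<xi> s\<bar> \<le> (\<Sum>s\<in>S. nat \<bar>\<xi> s\<bar>)"
      using that finite_S by (intro member_le_sum) auto
    then show ?thesis unfolding K_def by linarith
  qed
  have word: "\<bar>\<xi> (foldr (\<otimes>) ss \<one>)\<bar> \<le> int K * int (length ss)" if "set ss \<subseteq> S" for ss
    using that
  proof (induction ss)
    case Nil
    then show ?case using int_hom_one[OF \<xi>] by simp
  next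
    case (Cons s ss)
    have "\<bar>\<xi> (s \<otimes> foldr (\<otimes>) ss \<one>)\<bar> \<le> \<bar>\<xi> s\<bar> + \<bar>\<xi> (foldr (\<otimes>) ss \<one>)\<bar>"
      using int_hom_mult[OF \<xi>, of s "foldr (\<otimes>) ss \<one>"] Cons.prems S_carrier foldr_mult_closed[of ss]
      by simp
    also have "\<dots> \<le> int K + int K * int (length ss)"
      using Cons K by (intro add_mono) auto
    finally show ?case by (simp add: algebra_simps)
  qed
  have "\<bar>\<xi> g\<bar> \<le> int K * int (len g)" if "g \<in> carrier G" for g
    using geodesic_word[OF that] word by metis
  moreover have "0 < K" by (simp add: K_def)
  ultimately show ?thesis using that by blast
qed

text \<open>
  If both rays were short, \<open>v [^] n \<otimes> k\<close> and \<open>inv v [^] m \<otimes> k\<close> would be close to \<open>\<one>\<close>,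
  hence to each other; as powers of \<open>v\<close> are undistorted, \<open>n + m\<close> and then \<open>len k\<close> would be small.
\<close>

lemma ray_away:
  assumes \<xi>: "\<xi> \<in> hom G integer_group" "\<xi> v = 1" and v: "v \<in> carrier G"
  obtains K :: nat where "0 < K"
    "\<And>k. k \<in> carrier G \<Longrightarrow> (\<forall>n. len k + n \<le> K * len (v [^] n \<otimes> k)) \<or>
      (\<forall>n. len k + n \<le> K * len (inv v [^] n \<otimes> k))"
proof -
  obtain K1 where K1: "0 < K1" "\<And>g. g \<in> carrier G \<Longrightarrow> \<bar>\<xi> g\<bar> \<le> int K1 * int (len g)"
    using int_hom_lipschitz[OF \<xi>(1)] by blast
  define l where "l = Suc (len v)"
  \<comment> \<open>If both alternatives fail, adding the two inequalities and inserting the bound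
    on \<open>n + m\<close> gives \<open>K * (n + m) \<le> K1 * (2 * len k + (n + m))\<close>. The
    summand \<open>K1\<close> absorbs \<open>n + m\<close> on the right; the other summand yields
    \<open>2 * (l * n) \<le> len k\<close>. So v^n accounts for at most half of
    \<open>len k\<close>, the rest is at most \<open>a\<close>, and
    \<open>len k + n \<le> 3 * a\<close> contradicts \<open>5 \<le> K\<close>.\<close>
  define K where "K = K1 + 4 * K1 * l"
  have "0 < K" using K1 by (simp add: K_def)
  moreover have "(\<forall>n. len k + n \<le> K * len (v [^] n \<otimes> k)) \<or>
      (\<forall>n. len k + n \<le> K * len (inv v [^] n \<otimes> k))" if k: "k \<in> carrier G" for k
  proof (rule ccontr)
    assume "\<not> ?thesis"
    then obtain n m where nm: "K * len (v [^] n \<otimes> k) < len k + n"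
        "K * len (inv v [^] m \<otimes> k) < len k + m"
      by (auto simp: not_le)
    define a where "a = len (v [^] n \<otimes> k)"
    define b where "b = len (inv v [^] m \<otimes> k)"
    have "k \<otimes> (inv k \<otimes> v [^] m) = v [^] m"
      using v k by (simp add: m_assoc[symmetric])
    then have "(v [^] n \<otimes> k) \<otimes> inv (inv v [^] m \<otimes> k) = v [^] n \<otimes> v [^] m"
      using v k by (simp add: inv_mult_group nat_pow_inv m_assoc)
    also have "\<dots> = v [^] (n + m)" using v k by (simp add: nat_pow_mult)
    finally have eq: "v [^] (n + m) = (v [^] n \<otimes> k) \<otimes> inv (inv v [^] m \<otimes> k)" by simp
    have "int (n + m) \<le> int K1 * int (len (v [^] (n + m)))"
      using K1(2)[of "v [^] (n + m)"] int_hom_pow[OF \<xi>(1) v, of "n + m"] \<xi>(2) v by simp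
    also have "len (v [^] (n + m)) \<le> a + b"
      unfolding eq a_def b_def using v k len_mult[of "v [^] n \<otimes> k" "inv (inv v [^] m \<otimes> k)"]
      by (simp add: len_inv)
    finally have 1: "n + m \<le> K1 * (a + b)"
      using K1(1) by (metis mult_le_mono2 of_nat_le_iff of_nat_mult)
    have "len k \<le> len (inv (v [^] n)) + a"
      unfolding a_def using len_mult[of "inv (v [^] n)" "v [^] n \<otimes> k"] v k
      by (simp add: m_assoc[symmetric])
    also have "len (inv (v [^] n)) \<le> n * l"
      using len_pow[OF v, of n] v by (simp add: len_inv l_def)
    finally have 2: "len k \<le> n * l + a" by simp
    have "K * (n + m) \<le> K * (K1 * (a + b))" using 1 by (rule mult_le_mono2)
    also have "\<dots> = K1 * (K * a + K * b)" by (simp add: algebra_simps)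
    also have "\<dots> \<le> K1 * (2 * len k + (n + m))"
      using nm unfolding a_def b_def by (intro mult_le_mono2) linarith
    finally have "K1 * (2 * (2 * l * (n + m))) \<le> K1 * (2 * len k)"
      by (simp add: K_def algebra_simps)
    then have "2 * (2 * l * (n + m)) \<le> 2 * len k" using K1(1) by simp
    then have 3: "2 * (l * n) \<le> len k" by (simp add: distrib_left)
    have "n \<le> l * n" by (simp add: l_def)
    moreover have "len k \<le> l * n + a" using 2 by (simp add: mult.commute)
    ultimately have "len k + n \<le> 3 * a" using 3 by linarith
    moreover have "5 \<le> K"
      using K1(1) mult_le_mono[of 1 K1 1 l] by (simp add: K_def l_def)
    then have "5 * a \<le> K * a" by (rule mult_le_mono1)
    ultimately show False using nm(1) unfolding a_def by linarith
  qed
  ultimately show ?thesis using that by blast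
qed

end

section \<open>The full shift\<close>

context word_metric
begin

lemma shift_action_closed:
  "x \<in> full_shift G A \<Longrightarrow> g \<in> carrier G \<Longrightarrow> shift_action G g x \<in> full_shift G A"
  by (auto simp: full_shift_def shift_action_def)

lemma shift_action_apply:
  "h \<in> carrier G \<Longrightarrow> shift_action G g x h = x (inv g \<otimes> h)"
  by (simp add: shift_action_def)

lemma shift_action_mult:
  assumes "g \<in> carrier G" "h \<in> carrier G"
  shows "shift_action G (g \<otimes> h) x = shift_action G g (shift_action G h x)"
  using assms by (auto simp: shift_action_def inv_mult_group m_assoc fun_eq_iff)

lemma shift_action_one: "x \<in> full_shift G A \<Longrightarrow> shift_action G \<one> x = x"
  by (auto simp: shift_action_def full_shift_def PiE_iff extensional_def fun_eq_iff)

lemma shift_action_disagree: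
  assumes "g \<in> carrier G" "h \<in> carrier G" "shift_action G g x h \<noteq> shift_action G g y h"
  obtains k where "k \<in> carrier G" "x k \<noteq> y k" "h = g \<otimes> k"
  using assms that[of "inv g \<otimes> h"] by (simp add: shift_action_apply m_assoc[symmetric])

lemma restrict_word_ball_eq:
  assumes "\<And>k. k \<in> carrier G \<Longrightarrow> x k \<noteq> y k \<Longrightarrow> n < len k"
  shows "restrict x (word_ball G S n) = restrict y (word_ball G S n)"
  using assms by (force simp: word_ball_def restrict_def fun_eq_iff)

lemma restrict_word_ball_eqD:
  assumes "restrict x (word_ball G S n) = restrict y (word_ball G S n)"
    and "k \<in> carrier G" "x k \<noteq> y k"
  shows "n < len k"
proof (rule ccontr)
  assume "\<not> n < len k"
  then have "k \<in> word_ball G S n" using assms(2) by (simp add: word_ball_def)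
  then show False using assms(1,3) by (metis restrict_apply')
qed

text \<open>
  Hoelder continuity as given says nothing about configurations that differ at \<open>\<one>\<close>; for these,
  the bound (the case \<open>m = 0\<close>) comes from the finiteness of the alphabet.
\<close>

lemma holder_continuous_scaled:
  assumes f: "holder_continuous G S A H d f" and "Metric_space (carrier H) d"
    and "finite A" and K: "0 < (K::nat)"
  shows "\<exists>C r. 0 < C \<and> 0 < r \<and> r < (1::real) \<and>
    (\<forall>x\<in>full_shift G A. \<forall>y\<in>full_shift G A. \<forall>m.
      (\<forall>k\<in>carrier G. x k \<noteq> y k \<longrightarrow> m \<le> K * len k) \<longrightarrow> d (f x) (f y) \<le> C * r ^ m)"
proof -
  interpret Metric_space "carrier H" d by fact
  obtain C0 r0 where C0: "0 < C0" and r0: "0 < r0" "r0 < 1"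
    and bound: "\<And>n x y. x \<in> full_shift G A \<Longrightarrow> y \<in> full_shift G A \<Longrightarrow>
      restrict x (word_ball G S n) = restrict y (word_ball G S n) \<Longrightarrow> d (f x) (f y) \<le> C0 * r0 ^ n"
    using f unfolding holder_continuous_def by blast
  have fH: "f x \<in> carrier H" if "x \<in> full_shift G A" for x
    using f that by (auto simp: holder_continuous_def)
  have len_pos: "0 < len k" if "k \<in> carrier G" "k \<noteq> \<one>" for k
    using geodesic_word[OF that(1)] that(2) by fastforce
  have diam: "\<exists>D>0. \<forall>x\<in>full_shift G A. \<forall>y\<in>full_shift G A. d (f x) (f y) \<le> D"
  proof (cases "full_shift G A = {}")
    case False
    then obtain z where z: "z \<in> full_shift G A" by blast
    \<comment> \<open>Every configuration agrees at \<one>, hence on the ball of radius 0, with one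
      of the finitely many \<open>w a\<close>.\<close>
    define w where "w a = z(\<one> := a)" for a
    have w: "w a \<in> full_shift G A" if "a \<in> A" for a
      using z that by (auto simp: w_def full_shift_def PiE_iff extensional_def)
    define E where "E = (\<Sum>a\<in>A. d (f (w a)) (f z))"
    have E0: "0 \<le> E" by (simp add: E_def sum_nonneg)
    have near: "d (f x) (f z) \<le> C0 + E" if x: "x \<in> full_shift G A" for x
    proof -
      have x1: "x \<one> \<in> A" using x by (auto simp: full_shift_def)
      have "d (f x) (f (w (x \<one>))) \<le> C0 * r0 ^ 0"
        using w[OF x1] x len_pos by (intro bound restrict_word_ball_eq) (auto simp: w_def split: if_splits)
      moreover have "d (f (w (x \<one>))) (f z) \<le> E"
        unfolding E_def using x1 \<open>finite A\<close> by (intro member_le_sum) auto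
      ultimately show ?thesis
        using triangle[of "f x" "f (w (x \<one>))" "f z"] fH x z w[OF x1] by simp
    qed
    have "d (f x) (f y) \<le> 2 * (C0 + E)" if "x \<in> full_shift G A" "y \<in> full_shift G A" for x y
      using near[OF that(1)] near[OF that(2)] triangle[of "f x" "f z" "f y"] fH that z
        commute[of "f z" "f y"] by simp
    then show ?thesis using C0 E0 by (intro exI[of _ "2 * (C0 + E)"]) auto
  qed (auto intro: exI[of _ 1])
  then obtain D where D: "0 < D" "\<And>x y. x \<in> full_shift G A \<Longrightarrow> y \<in> full_shift G A \<Longrightarrow> d (f x) (f y) \<le> D"
    by blast
  \<comment> \<open>The hypothesis measures lengths in units of 1/K, hence the K-th root. The
    division by \<open>r ^ K\<close> in \<open>C\<close> pays for rounding down to a multiple of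
    \<open>K\<close>.\<close>
  define r where "r = root K r0"
  have r: "0 < r" "r < 1" "r ^ K = r0" using r0 K by (auto simp: r_def)
  define C where "C = D + C0 / r ^ K"
  have "0 < C" using D(1) C0 r r0 by (simp add: C_def add_pos_pos)
  moreover have "d (f x) (f y) \<le> C * r ^ m"
    if x: "x \<in> full_shift G A" and y: "y \<in> full_shift G A"
      and away: "\<forall>k\<in>carrier G. x k \<noteq> y k \<longrightarrow> m \<le> K * len k" for x y m
  proof (cases m)
    case 0
    have "D \<le> C" using C0 r r0 by (simp add: C_def)
    then show ?thesis using D(2)[OF x y] 0 by simp
  next
    case (Suc m')
    \<comment> \<open>The predecessor \<open>m'\<close> is divided instead of \<open>m\<close>:
      agreement on the closed ball of radius \<open>n\<close> needs the strict bound
      \<open>n < len k\<close>, while only \<open>m \<le> K * len k\<close> is given.\<close>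
    define n where "n = m' div K"
    have "K * n \<le> m'" "m' < K * n + K"
      using K by (auto simp: n_def) (metis add.commute dividend_less_times_div mult.commute)
    have "n < len k" if "k \<in> carrier G" "x k \<noteq> y k" for k
    proof (rule ccontr)
      assume "\<not> n < len k"
      then have "K * len k \<le> K * n" by simp
      moreover have "m \<le> K * len k" using away that by blast
      ultimately show False using \<open>K * n \<le> m'\<close> Suc by linarith
    qed
    then have "d (f x) (f y) \<le> C0 * r0 ^ n" using x y by (intro bound restrict_word_ball_eq)
    also have "r0 ^ n = r ^ (K * n + K) / r ^ K"
      using r r0 by (simp add: power_mult power_add)
    also have "\<dots> \<le> r ^ m / r ^ K"
      using r Suc \<open>m' < K * n + K\<close> by (intro divide_right_mono power_decreasing) auto
    finally have "d (f x) (f y) \<le> C0 * (r ^ m / r ^ K)" using C0 by simp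
    also have "\<dots> \<le> C * r ^ m" using D(1) r r0 by (simp add: C_def distrib_right)
    finally show ?thesis .
  qed
  ultimately show ?thesis using r by blast
qed

end

section \<open>Hoelder cocycles and their limits along rays\<close>

locale holder_cocycle_on_shift =
  word_metric G S + H: group H + M: Metric_space "carrier H" d
  for G :: "('g, 'm) monoid_scheme" (structure) and S
    and H :: "('h, 'n) monoid_scheme" and d +
  fixes A :: "'a set" and c :: "'g \<Rightarrow> ('g \<Rightarrow> 'a) \<Rightarrow> 'h" and a\<^sub>0 :: 'a
  assumes finite_alphabet: "finite A" and base_letter: "a\<^sub>0 \<in> A"
    and left_invariant: "\<lbrakk>g \<in> carrier H; x \<in> carrier H; y \<in> carrier H\<rbrakk> \<Longrightarrow>
      d (g \<otimes>\<^bsub>H\<^esub> x) (g \<otimes>\<^bsub>H\<^esub> y) = d x y"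
    and right_invariant: "\<lbrakk>g \<in> carrier H; x \<in> carrier H; y \<in> carrier H\<rbrakk> \<Longrightarrow>
      d (x \<otimes>\<^bsub>H\<^esub> g) (y \<otimes>\<^bsub>H\<^esub> g) = d x y"
    and complete: "M.mcomplete"
    and holder_cocycle: "holder_cocycle G S A H d c"
begin

abbreviation X where "X \<equiv> full_shift G A"
abbreviation act where "act \<equiv> shift_action G"

definition base :: "'g \<Rightarrow> 'a" where "base = (\<lambda>k\<in>carrier G. a\<^sub>0)"

definition X_fin :: "('g \<Rightarrow> 'a) set" where
  "X_fin = {x \<in> X. finite {k \<in> carrier G. x k \<noteq> a\<^sub>0}}"

definition \<phi> :: "'g \<Rightarrow> 'h" where "\<phi> g = c g base"

text \<open>If c is cohomologous to \<phi> through a continuous b with b(\<open>base\<close>) = 1,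
  then \<open>dev x g\<close> is \<phi>(g)^-1 b(gx)^-1 \<phi>(g) b(x). Conjugation preserves the
  distance to the identity, so \<open>dev x g\<close> tends to b(x) whenever gx tends to
  \<open>base\<close>: the limits of \<open>dev\<close> are the only candidates for b.\<close>

definition dev :: "('g \<Rightarrow> 'a) \<Rightarrow> 'g \<Rightarrow> 'h" where
  "dev x g = inv\<^bsub>H\<^esub> \<phi> g \<otimes>\<^bsub>H\<^esub> c g x"

lemma c_closed: "g \<in> carrier G \<Longrightarrow> x \<in> X \<Longrightarrow> c g x \<in> carrier H"
  and c_mult: "g \<in> carrier G \<Longrightarrow> h \<in> carrier G \<Longrightarrow> x \<in> X \<Longrightarrow>
    c (g \<otimes> h) x = c g (act h x) \<otimes>\<^bsub>H\<^esub> c h x"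
  and c_holder: "g \<in> carrier G \<Longrightarrow> holder_continuous G S A H d (c g)"
  using holder_cocycle by (simp_all add: holder_cocycle_def cocycle_def)

lemma base_in: "base \<in> X"
  using base_letter by (simp add: base_def full_shift_def)

lemma act_base: "g \<in> carrier G \<Longrightarrow> act g base = base"
  by (auto simp: base_def shift_action_def fun_eq_iff)

lemma X_fin_X: "x \<in> X_fin \<Longrightarrow> x \<in> X"
  by (simp add: X_fin_def)

lemma act_X_fin:
  assumes x: "x \<in> X_fin" and g: "g \<in> carrier G"
  shows "act g x \<in> X_fin"
proof -
  have "{k \<in> carrier G. act g x k \<noteq> a\<^sub>0} \<subseteq> (\<otimes>) g ` {k \<in> carrier G. x k \<noteq> a\<^sub>0}"
  proof
    fix k assume k: "k \<in> {k \<in> carrier G. act g x k \<noteq> a\<^sub>0}"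
    then have "k = g \<otimes> (inv g \<otimes> k)" using g by (simp add: m_assoc[symmetric])
    then show "k \<in> (\<otimes>) g ` {k \<in> carrier G. x k \<noteq> a\<^sub>0}"
      using k g by (auto simp: shift_action_apply)
  qed
  moreover have "finite {k \<in> carrier G. x k \<noteq> a\<^sub>0}" using x by (simp add: X_fin_def)
  ultimately have "finite {k \<in> carrier G. act g x k \<noteq> a\<^sub>0}" by (rule finite_surj[rotated])
  then show ?thesis
    using x g by (simp add: X_fin_def shift_action_closed)
qed

lemma \<phi>_closed: "g \<in> carrier G \<Longrightarrow> \<phi> g \<in> carrier H"
  by (simp add: \<phi>_def c_closed base_in)

lemma \<phi>_mult: "g \<in> carrier G \<Longrightarrow> h \<in> carrier G \<Longrightarrow> \<phi> (g \<otimes> h) = \<phi> g \<otimes>\<^bsub>H\<^esub> \<phi> h"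
  by (simp add: \<phi>_def c_mult act_base base_in)

lemma \<phi>_hom: "\<phi> \<in> hom G H"
  by (simp add: hom_def \<phi>_closed \<phi>_mult)

lemma dev_closed: "g \<in> carrier G \<Longrightarrow> x \<in> X \<Longrightarrow> dev x g \<in> carrier H"
  by (simp add: dev_def \<phi>_closed c_closed)

lemma dist_mult_le:
  assumes "a \<in> carrier H" "b \<in> carrier H" "a' \<in> carrier H" "b' \<in> carrier H"
  shows "d (a \<otimes>\<^bsub>H\<^esub> b) (a' \<otimes>\<^bsub>H\<^esub> b') \<le> d a a' + d b b'"
  using M.triangle[of "a \<otimes>\<^bsub>H\<^esub> b" "a' \<otimes>\<^bsub>H\<^esub> b" "a' \<otimes>\<^bsub>H\<^esub> b'"] assms
  by (simp add: left_invariant right_invariant)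

lemma dist_dev:
  "g \<in> carrier G \<Longrightarrow> x \<in> X \<Longrightarrow> y \<in> X \<Longrightarrow> d (dev x g) (dev y g) = d (c g x) (c g y)"
  by (simp add: dev_def left_invariant \<phi>_closed c_closed)

text \<open>Left multiplication by \<phi>(sp) removes the inverses, and right cancellation of
  \<open>c p x\<close> removes the history up to p. What is left is a single step s, taken at the
  translate \<open>act p x\<close>, which is close to \<open>base\<close> once the support has moved
  away.\<close>

lemma dist_dev_step:
  assumes s: "s \<in> carrier G" and p: "p \<in> carrier G" and x: "x \<in> X"
  shows "d (dev x (s \<otimes> p)) (dev x p) = d (c s (act p x)) (c s base)"
proof -
  have in_H: "\<phi> s \<in> carrier H" "\<phi> p \<in> carrier H" "c p x \<in> carrier H" "c s (act p x) \<in> carrier H"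
    using s p x by (simp_all add: \<phi>_closed c_closed shift_action_closed)
  let ?q = "\<phi> s \<otimes>\<^bsub>H\<^esub> \<phi> p"
  have "?q \<otimes>\<^bsub>H\<^esub> dev x (s \<otimes> p) = c s (act p x) \<otimes>\<^bsub>H\<^esub> c p x"
    using s p x in_H by (simp add: dev_def \<phi>_mult c_mult H.m_assoc[symmetric])
  moreover have "?q \<otimes>\<^bsub>H\<^esub> dev x p = \<phi> s \<otimes>\<^bsub>H\<^esub> c p x"
  proof -
    have "\<phi> p \<otimes>\<^bsub>H\<^esub> (inv\<^bsub>H\<^esub> \<phi> p \<otimes>\<^bsub>H\<^esub> c p x) = c p x"
      using in_H by (simp add: H.m_assoc[symmetric])
    then show ?thesis using in_H by (simp add: dev_def H.m_assoc)
  qed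
  ultimately have "d (dev x (s \<otimes> p)) (dev x p) = d (c s (act p x) \<otimes>\<^bsub>H\<^esub> c p x) (\<phi> s \<otimes>\<^bsub>H\<^esub> c p x)"
    using left_invariant[of ?q "dev x (s \<otimes> p)" "dev x p"] in_H s p x by (simp add: dev_closed)
  then show ?thesis using in_H by (simp add: right_invariant \<phi>_def[symmetric])
qed

section \<open>Hoelder estimates for the cocycle along translates\<close>

lemma holder_uniform:
  assumes "finite F" "F \<subseteq> carrier G" and K: "0 < (K::nat)"
  shows "\<exists>C r. 0 < C \<and> 0 < r \<and> r < (1::real) \<and> (\<forall>s\<in>F. \<forall>x\<in>X. \<forall>y\<in>X. \<forall>m.
      (\<forall>k\<in>carrier G. x k \<noteq> y k \<longrightarrow> m \<le> K * len k) \<longrightarrow> d (c s x) (c s y) \<le> C * r ^ m)"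
  using assms(1,2)
proof (induction F rule: finite_induct)
  case empty
  show ?case by (intro exI[of _ "1/2"]) simp
next
  case (insert s F)
  then obtain C r where C: "0 < C" "0 < r" "r < 1"
    and *: "\<forall>s\<in>F. \<forall>x\<in>X. \<forall>y\<in>X. \<forall>m.
      (\<forall>k\<in>carrier G. x k \<noteq> y k \<longrightarrow> m \<le> K * len k) \<longrightarrow> d (c s x) (c s y) \<le> C * r ^ m"
    by auto
  have s: "s \<in> carrier G" using insert.prems by simp
  obtain C' r' where C': "0 < C'" "0 < r'" "r' < 1"
    and **: "\<forall>x\<in>X. \<forall>y\<in>X. \<forall>m.
      (\<forall>k\<in>carrier G. x k \<noteq> y k \<longrightarrow> m \<le> K * len k) \<longrightarrow> d (c s x) (c s y) \<le> C' * r' ^ m"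
    using holder_continuous_scaled[OF c_holder[OF s] M.Metric_space_axioms finite_alphabet K] by blast
  have max: "C * r ^ m \<le> max C C' * max r r' ^ m" "C' * r' ^ m \<le> max C C' * max r r' ^ m" for m
    using C C' by (auto intro!: mult_mono power_mono)
  have "d (c t x) (c t y) \<le> max C C' * max r r' ^ m"
    if "t \<in> insert s F" "x \<in> X" "y \<in> X" "\<forall>k\<in>carrier G. x k \<noteq> y k \<longrightarrow> m \<le> K * len k" for t x y m
  proof (cases "t = s")
    case True
    then show ?thesis using ** that max(2)[of m] by (meson order_trans)
  next
    case False
    then show ?thesis using * that max(1)[of m] by (meson insertE order_trans)
  qed
  then show ?case using C C' by (intro exI[of _ "max C C'"] exI[of _ "max r r'"]) (auto simp: less_max_iff_disj)
qed

text \<open>The translate differs from \<open>base\<close> only at points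
  \<open>p \<otimes> k\<close> with k in the finite support of x. There \<xi> is at least \<xi>(p)
  minus a constant, which forces these points away from \<one>.\<close>

lemma decay:
  assumes F: "finite F" "F \<subseteq> carrier G" and x: "x \<in> X_fin" and \<xi>: "\<xi> \<in> hom G integer_group"
  shows "\<exists>C r. 0 < C \<and> 0 < r \<and> r < (1::real) \<and> (\<forall>s\<in>F. \<forall>p\<in>carrier G. \<forall>m.
    int m \<le> \<xi> p \<longrightarrow> d (c s (act p x)) (c s base) \<le> C * r ^ m)"
proof -
  obtain K :: nat where K: "0 < K" "\<And>g. g \<in> carrier G \<Longrightarrow> \<bar>\<xi> g\<bar> \<le> int K * int (len g)"
    using int_hom_lipschitz[OF \<xi>] by blast
  obtain C r where C: "0 < C" "0 < r" "r < 1"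
    and bound: "\<forall>s\<in>F. \<forall>y\<in>X. \<forall>z\<in>X. \<forall>m.
      (\<forall>k\<in>carrier G. y k \<noteq> z k \<longrightarrow> m \<le> K * len k) \<longrightarrow> d (c s y) (c s z) \<le> C * r ^ m"
    using holder_uniform[OF F K(1)] by blast
  define supp where "supp = {k \<in> carrier G. x k \<noteq> a\<^sub>0}"
  \<comment> \<open>This constant depends on the support of x, and through it so does the final
    constant. The Hoelder bound for b therefore has to come from \<open>ray_limit_close\<close>
    instead.\<close>
  define e where "e = (\<Sum>k\<in>supp. nat \<bar>\<xi> k\<bar>)"
  have supp: "\<bar>\<xi> k\<bar> \<le> int e" if "k \<in> supp" for k
  proof -
    have "nat \<bar>\<xi> k\<bar> \<le> e"
      unfolding e_def using that x by (intro member_le_sum) (auto simp: supp_def X_fin_def)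
    then show ?thesis by linarith
  qed
  have "d (c s (act p x)) (c s base) \<le> C / r ^ e * r ^ m"
    if s: "s \<in> F" and p: "p \<in> carrier G" and m: "int m \<le> \<xi> p" for s p m
  proof -
    have "m - e \<le> K * len h" if h: "h \<in> carrier G" "act p x h \<noteq> base h" for h
    proof -
      have "act p x h \<noteq> act p base h" using h p by (simp add: act_base)
      then obtain k where k: "k \<in> carrier G" "x k \<noteq> base k" "h = p \<otimes> k"
        using shift_action_disagree[OF p h(1)] by blast
      then have "k \<in> supp" by (simp add: supp_def base_def)
      then have "int m - int e \<le> \<xi> h"
        using supp[of k] m k p int_hom_mult[OF \<xi>, of p k] by simp
      then have "int m - int e \<le> int (K * len h)" using K(2)[OF h(1)] by simp
      then show ?thesis by linarith
    qed
    then have "d (c s (act p x)) (c s base) \<le> C * r ^ (m - e)"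
      using s p x base_in by (intro bound[rule_format]) (auto simp: shift_action_closed X_fin_X)
    \<comment> \<open>Holds also where the subtraction is cut off at 0, since then
      \<open>m - e + e\<close> exceeds \<open>m\<close>.\<close>
    also have "r ^ (m - e) * r ^ e \<le> r ^ m"
      using C by (simp add: power_add[symmetric] power_decreasing)
    then have "C * r ^ (m - e) \<le> C / r ^ e * r ^ m" using C by (simp add: field_simps)
    finally show ?thesis .
  qed
  then show ?thesis using C by (intro exI[of _ "C / r ^ e"] exI[of _ r]) auto
qed

section \<open>Limits along rays: existence, comparison, equivariance and uniform closeness\<close>

definition ray_limit :: "'g \<Rightarrow> ('g \<Rightarrow> 'a) \<Rightarrow> 'h \<Rightarrow> bool" where
  "ray_limit g x l \<longleftrightarrow> l \<in> carrier H \<and> (\<lambda>n. d (dev x (g [^] (n::nat))) l) \<longlonglongrightarrow> 0"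

lemma ray_limit_exists:
  assumes g: "g \<in> carrier G" and \<xi>: "\<xi> \<in> hom G integer_group" "\<xi> g = 1" and x: "x \<in> X_fin"
  obtains l where "ray_limit g x l"
proof -
  have F: "finite {g}" "{g} \<subseteq> carrier G" using g by simp_all
  obtain C r where C: "0 < C" "0 < r" "r < 1" and bound: "\<forall>s\<in>{g}. \<forall>p\<in>carrier G. \<forall>m.
      int m \<le> \<xi> p \<longrightarrow> d (c s (act p x)) (c s base) \<le> C * r ^ m"
    using decay[OF F x \<xi>(1)] by blast
  have "d (dev x (g [^] n)) (dev x (g [^] Suc n)) \<le> C * r ^ n" for n
  proof -
    have "d (dev x (g [^] n)) (dev x (g [^] Suc n)) = d (dev x (g \<otimes> g [^] n)) (dev x (g [^] n))"
      using g by (simp only: nat_pow_Suc2 M.commute)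
    also have "\<dots> \<le> C * r ^ n"
      using bound[rule_format, of g "g [^] n" n] int_hom_pow[OF \<xi>(1) g, of n] \<xi>(2) g x
      by (simp add: dist_dev_step X_fin_X)
    finally show ?thesis .
  qed
  then obtain l where "l \<in> carrier H" "(\<lambda>n. d (dev x (g [^] n)) l) \<longlonglongrightarrow> 0"
    using M.geometric_increments_convergent[OF complete, of "\<lambda>n. dev x (g [^] n)" C r] C g x
    by (metis X_fin_X dev_closed less_imp_le nat_pow_closed)
  then show ?thesis using that by (simp add: ray_limit_def)
qed

text \<open>With a zero bound it turns an identity along two sequences into one between their
  limits; with a constant bound it carries Hoelder estimates over to the limits.\<close>

lemma dist_limit_le:
  assumes "\<And>n. u n \<in> carrier H" "\<And>n. w n \<in> carrier H" "l \<in> carrier H" "l' \<in> carrier H"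
    and "(\<lambda>n. d (u n) l) \<longlonglongrightarrow> 0" "(\<lambda>n. d (w n) l') \<longlonglongrightarrow> 0"
    and le: "\<And>n. d (u n) (w n) \<le> B n" and B: "B \<longlonglongrightarrow> \<beta>"
  shows "d l l' \<le> \<beta>"
proof -
  have "d l l' \<le> d (u n) l + B n + d (w n) l'" for n
    using M.triangle[of l "u n" l'] M.triangle[of "u n" "w n" l'] assms(1-4) le[of n]
      M.commute[of l "u n"] by fastforce
  moreover have "(\<lambda>n. d (u n) l + B n + d (w n) l') \<longlonglongrightarrow> 0 + \<beta> + 0"
    using assms by (intro tendsto_add)
  ultimately show ?thesis by (intro LIMSEQ_le_const[of _ "\<beta>"]) auto
qed

lemma eq_if_dist_le_0: "l \<in> carrier H \<Longrightarrow> l' \<in> carrier H \<Longrightarrow> d l l' \<le> 0 \<Longrightarrow> l = l'"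
  using M.zero[of l l'] M.nonneg[of l l'] by linarith

text \<open>Compare the two rays at \<open>g [^] n \<otimes> h [^] n\<close>: every step of the detours starts at a \<open>\<xi>\<close>-value of at least \<open>n\<close>.\<close>

lemma ray_limit_commuting:
  assumes g: "g \<in> carrier G" and h: "h \<in> carrier G" and comm: "g \<otimes> h = h \<otimes> g"
    and \<xi>: "\<xi> \<in> hom G integer_group" "\<xi> g = 1" "\<xi> h = 1" and x: "x \<in> X_fin"
    and lim: "ray_limit g x l"
  shows "ray_limit h x l"
proof -
  have F: "finite {g, h}" "{g, h} \<subseteq> carrier G" using g h by simp_all
  obtain C r where C: "0 < C" "0 < r" "r < 1" and bound: "\<forall>s\<in>{g, h}. \<forall>p\<in>carrier G. \<forall>m.
      int m \<le> \<xi> p \<longrightarrow> d (c s (act p x)) (c s base) \<le> C * r ^ m"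
    using decay[OF F x \<xi>(1)] by blast
  let ?B = "\<lambda>n. C / (1 - r) * r ^ n"
  \<comment> \<open>The walk leaves t^n and multiplies by s one step at a time. Its i-th step starts
    at the \<xi>-value n + i, so the geometric series carries the factor
    \<open>r ^ n\<close>.\<close>
  have detour: "d (dev x (t [^] n)) (dev x (s [^] n \<otimes> t [^] n)) \<le> ?B n"
    if s: "s \<in> {g, h}" and t: "t \<in> {g, h}" for s t and n :: nat
  proof -
    have st: "s \<in> carrier G" "t \<in> carrier G" "\<xi> s = 1" "\<xi> t = 1" using s t g h \<xi> by auto
    define u where "u i = dev x (s [^] i \<otimes> t [^] n)" for i :: nat
    have "d (u i) (u (Suc i)) \<le> C * r ^ n * r ^ i" for i
    proof -
      have "d (u i) (u (Suc i)) = d (dev x (s \<otimes> (s [^] i \<otimes> t [^] n))) (dev x (s [^] i \<otimes> t [^] n))"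
        unfolding u_def using st by (simp only: nat_pow_Suc2 M.commute m_assoc nat_pow_closed)
      also have "\<dots> = d (c s (act (s [^] i \<otimes> t [^] n) x)) (c s base)"
        using st x by (simp add: dist_dev_step X_fin_X)
      also have "\<dots> \<le> C * r ^ (n + i)"
        using st s int_hom_pow[OF \<xi>(1), of s i] int_hom_pow[OF \<xi>(1), of t n]
        by (intro bound[rule_format]) (auto simp: int_hom_mult[OF \<xi>(1)])
      finally show ?thesis by (simp add: power_add)
    qed
    moreover have "u i \<in> carrier H" for i
      using st x by (simp add: u_def dev_closed X_fin_X)
    ultimately have "d (u 0) (u (0 + n)) \<le> C * r ^ n / (1 - r) * r ^ 0"
      using C by (intro M.geometric_increments_bound) auto
    then show ?thesis using st by (simp add: u_def)
  qed
  have B: "?B \<longlonglongrightarrow> 0"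
    using C by (intro tendsto_mult_right_zero LIMSEQ_realpow_zero) auto
  have dev_h: "d (dev x (h [^] n)) l \<le> 2 * ?B n + d (dev x (g [^] n)) l" for n
  proof -
    \<comment> \<open>Commutation makes the two detours end at the same element.\<close>
    have "g [^] n \<otimes> h [^] n = h [^] n \<otimes> g [^] n"
      using pow_mult_distrib[OF comm g h, of n] pow_mult_distrib[OF comm[symmetric] h g, of n] comm
      by simp
    then have "d (dev x (g [^] n)) (dev x (g [^] n \<otimes> h [^] n)) \<le> ?B n"
        "d (dev x (h [^] n)) (dev x (g [^] n \<otimes> h [^] n)) \<le> ?B n"
      using detour[of h g n] detour[of g h n] by auto
    moreover have "dev x (h [^] n) \<in> carrier H" "dev x (g [^] n) \<in> carrier H" "l \<in> carrier H"
        "dev x (g [^] n \<otimes> h [^] n) \<in> carrier H"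
      using g h x lim by (auto simp: dev_closed X_fin_X ray_limit_def)
    ultimately show ?thesis
      using M.triangle[of "dev x (h [^] n)" "dev x (g [^] n)" l]
        M.triangle[of "dev x (h [^] n)" "dev x (g [^] n \<otimes> h [^] n)" "dev x (g [^] n)"]
        M.commute[of "dev x (g [^] n)" "dev x (g [^] n \<otimes> h [^] n)"] by linarith
  qed
  have "(\<lambda>n. 2 * ?B n + d (dev x (g [^] n)) l) \<longlonglongrightarrow> 2 * 0 + 0"
    using lim by (intro tendsto_add tendsto_mult_left B) (simp add: ray_limit_def)
  then have majorant: "(\<lambda>n. 2 * ?B n + d (dev x (g [^] n)) l) \<longlonglongrightarrow> 0" by simp
  have "(\<lambda>n. d (dev x (h [^] n)) l) \<longlonglongrightarrow> 0"
    by (rule tendsto_sandwich[OF _ _ tendsto_const majorant]) (use dev_h in simp_all)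
  then show ?thesis using lim by (simp add: ray_limit_def)
qed

lemma ray_limit_equivariant:
  assumes g: "g \<in> carrier G" and x: "x \<in> X" and l: "ray_limit g x l" and l': "ray_limit g (act g x) l'"
  shows "l' \<otimes>\<^bsub>H\<^esub> c g x = \<phi> g \<otimes>\<^bsub>H\<^esub> l"
proof -
  have in_H: "\<phi> g \<in> carrier H" "c g x \<in> carrier H" "l \<in> carrier H" "l' \<in> carrier H"
    using g x l l' by (auto simp: \<phi>_closed c_closed ray_limit_def)
  have eq: "dev (act g x) (g [^] n) \<otimes>\<^bsub>H\<^esub> c g x = \<phi> g \<otimes>\<^bsub>H\<^esub> dev x (g [^] Suc n)" for n :: nat
  proof -
    have cl: "\<phi> (g [^] n) \<in> carrier H" "c (g [^] n) (act g x) \<in> carrier H"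
      using g x by (auto simp: \<phi>_closed c_closed shift_action_closed)
    have "\<phi> (g [^] Suc n) = \<phi> (g [^] n) \<otimes>\<^bsub>H\<^esub> \<phi> g"
      using g by (simp add: \<phi>_mult)
    moreover have "c (g [^] Suc n) x = c (g [^] n) (act g x) \<otimes>\<^bsub>H\<^esub> c g x"
      using g x by (simp add: c_mult)
    ultimately show ?thesis
      using in_H cl by (simp add: dev_def H.inv_mult_group H.m_assoc[symmetric] del: nat_pow_Suc)
  qed
  have "d (l' \<otimes>\<^bsub>H\<^esub> c g x) (\<phi> g \<otimes>\<^bsub>H\<^esub> l) \<le> 0"
  proof (rule dist_limit_le)
    show "(\<lambda>n. d (dev (act g x) (g [^] n) \<otimes>\<^bsub>H\<^esub> c g x) (l' \<otimes>\<^bsub>H\<^esub> c g x)) \<longlonglongrightarrow> 0"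
      using l' in_H g x by (simp add: right_invariant ray_limit_def dev_closed shift_action_closed)
    show "(\<lambda>n. d (\<phi> g \<otimes>\<^bsub>H\<^esub> dev x (g [^] Suc n)) (\<phi> g \<otimes>\<^bsub>H\<^esub> l)) \<longlonglongrightarrow> 0"
      using l in_H g x LIMSEQ_Suc[of "\<lambda>n. d (dev x (g [^] n)) l" 0]
      by (simp add: left_invariant ray_limit_def dev_closed)
    show "d (dev (act g x) (g [^] n) \<otimes>\<^bsub>H\<^esub> c g x) (\<phi> g \<otimes>\<^bsub>H\<^esub> dev x (g [^] Suc n)) \<le> 0" for n
      using in_H g x by (simp add: eq dev_closed del: nat_pow_Suc)
  qed (use in_H g x in \<open>auto simp: dev_closed shift_action_closed\<close>)
  then show ?thesis using in_H by (intro eq_if_dist_le_0) auto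
qed

text \<open>Here x and y are compared with each other and not with \<open>base\<close>, so the size
  of their supports does not enter: the constants depend on v and \<open>K\<close> alone.\<close>

lemma ray_limit_close:
  assumes v: "v \<in> carrier G" and K: "0 < (K::nat)"
  shows "\<exists>C r. 0 < C \<and> 0 < r \<and> r < (1::real) \<and> (\<forall>x\<in>X. \<forall>y\<in>X. \<forall>l l' m.
    ray_limit v x l \<longrightarrow> ray_limit v y l' \<longrightarrow>
    (\<forall>k\<in>carrier G. x k \<noteq> y k \<longrightarrow> (\<forall>n. m + n \<le> K * len (v [^] n \<otimes> k))) \<longrightarrow> d l l' \<le> C * r ^ m)"
proof -
  obtain C r where C: "0 < C" "0 < r" "r < 1"
    and bound: "\<forall>s\<in>{v}. \<forall>y\<in>X. \<forall>z\<in>X. \<forall>m.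
      (\<forall>k\<in>carrier G. y k \<noteq> z k \<longrightarrow> m \<le> K * len k) \<longrightarrow> d (c s y) (c s z) \<le> C * r ^ m"
    using holder_uniform[of "{v}" K] v K by (simp del: ball_simps) blast
  have "d l l' \<le> C / (1 - r) * r ^ m"
    if x: "x \<in> X" and y: "y \<in> X" and l: "ray_limit v x l" and l': "ray_limit v y l'"
      and away: "\<forall>k\<in>carrier G. x k \<noteq> y k \<longrightarrow> (\<forall>n. m + n \<le> K * len (v [^] n \<otimes> k))" for x y l l' m
  proof -
    have dev_close: "d (dev x (v [^] n)) (dev y (v [^] n)) \<le> C / (1 - r) * r ^ m" for n :: nat
    proof -
      have step: "d (c v (act (v [^] i) x)) (c v (act (v [^] i) y)) \<le> C * r ^ (m + i)" for i :: nat
      proof (intro bound[rule_format])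
        fix h assume h: "h \<in> carrier G" "act (v [^] i) x h \<noteq> act (v [^] i) y h"
        then obtain k where "k \<in> carrier G" "x k \<noteq> y k" "h = v [^] i \<otimes> k"
          using shift_action_disagree[of "v [^] i" h x y] v by auto
        then show "m + i \<le> K * len h" using away by simp
      qed (use x y v in \<open>auto simp: shift_action_closed\<close>)
      \<comment> \<open>The cocycle identity splits c(v^n, -) into n single steps, and by
        \<open>dist_mult_le\<close> the errors of the factors add up.\<close>
      have "d (c (v [^] n) x) (c (v [^] n) y) \<le> C * r ^ m * (\<Sum>i<n. r ^ i)"
      proof (induction n)
        case 0
        have "c \<one> z = \<one>\<^bsub>H\<^esub>" if "z \<in> X" for z
          using c_mult[of \<one> \<one> z] that c_closed[of \<one> z]
          by (simp add: shift_action_one H.r_cancel_one)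
        then show ?case using x y by simp
      next
        case (Suc n)
        have "c (v [^] Suc n) z = c v (act (v [^] n) z) \<otimes>\<^bsub>H\<^esub> c (v [^] n) z" if "z \<in> X" for z
          using c_mult[of v "v [^] n" z] v that by (simp only: nat_pow_Suc2 nat_pow_closed)
        then have "d (c (v [^] Suc n) x) (c (v [^] Suc n) y) \<le>
            d (c v (act (v [^] n) x)) (c v (act (v [^] n) y)) + d (c (v [^] n) x) (c (v [^] n) y)"
          using x y v by (simp add: dist_mult_le c_closed shift_action_closed del: nat_pow_Suc)
        also have "\<dots> \<le> C * r ^ (m + n) + C * r ^ m * (\<Sum>i<n. r ^ i)"
          using Suc step by (intro add_mono)
        finally show ?case by (simp add: algebra_simps power_add)
      qed
      also have "\<dots> \<le> C * r ^ m * (1 / (1 - r))"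
      proof (intro mult_left_mono)
        show "(\<Sum>i<n. r ^ i) \<le> 1 / (1 - r)"
          using C by (subst sum_gp_strict) (auto simp: divide_right_mono)
      qed (use C in auto)
      finally show ?thesis using x y v by (simp add: dist_dev)
    qed
    show ?thesis
      by (rule dist_limit_le[of "\<lambda>n. dev x (v [^] n)" "\<lambda>n. dev y (v [^] n)" _ _ "\<lambda>_. C / (1 - r) * r ^ m"])
        (use dev_close l l' x y v in \<open>simp_all add: ray_limit_def dev_closed\<close>)
  qed
  then show ?thesis using C by (intro exI[of _ "C / (1 - r)"] exI[of _ r]) auto
qed

end

section \<open>Generators linked by commutation\<close>

text \<open>
  The homomorphism to the integers makes all \<open>g [^] n \<otimes> h [^] m\<close> with nonnegative exponents
  undistorted, which replaces the requirement that \<open>g\<close> and \<open>h\<close> span a copy of \<open>\<int>\<^sup>2\<close>.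
\<close>

definition linked :: "('g, 'm) monoid_scheme \<Rightarrow> 'g set \<Rightarrow> ('g \<times> 'g) set" where
  "linked G D = {(g, h). g \<in> D \<and> h \<in> D \<and> g \<otimes>\<^bsub>G\<^esub> h = h \<otimes>\<^bsub>G\<^esub> g \<and>
    (\<exists>\<xi>\<in>hom G integer_group. \<xi> g = 1 \<and> \<xi> h = 1)}"

text \<open>The closure \<open>\<^sup>+\<close> demands at least one link even from an element to
  itself; this provides the homomorphism in \<open>D_hom\<close>. Applied to g and
  \<open>inv g\<close>, it makes the limits along opposite rays equal.\<close>

locale linked_holder_cocycle = holder_cocycle_on_shift +
  fixes D
  assumes D_carrier: "D \<subseteq> carrier G" and D_nonempty: "D \<noteq> {}"
    and D_inv: "g \<in> D \<Longrightarrow> inv g \<in> D" and D_generate: "generate G D = carrier G"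
    and D_linked: "g \<in> D \<Longrightarrow> h \<in> D \<Longrightarrow> (g, h) \<in> (linked G D)\<^sup>+"
begin

definition b_fin where "b_fin x = (SOME l. \<forall>g\<in>D. ray_limit g x l)"

lemma D_hom:
  assumes "v \<in> D"
  obtains \<xi> where "\<xi> \<in> hom G integer_group" "\<xi> v = 1"
proof -
  obtain h where "(v, h) \<in> linked G D" using D_linked[OF assms assms] by (meson tranclD)
  then show ?thesis using that by (auto simp: linked_def)
qed

lemma ray_limit_b_fin:
  assumes x: "x \<in> X_fin" and g: "g \<in> D"
  shows "ray_limit g x (b_fin x)"
proof -
  obtain v where v: "v \<in> D" using D_nonempty by blast
  obtain \<xi> where "\<xi> \<in> hom G integer_group" "\<xi> v = 1" using D_hom[OF v] by blast
  then obtain l where l: "ray_limit v x l"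
    using ray_limit_exists[of v \<xi> x] v D_carrier x by blast
  have step: "ray_limit h' x l" if "ray_limit h x l" "(h, h') \<in> linked G D" for h h'
    using that ray_limit_commuting[of h h' _ x l] x D_carrier unfolding linked_def by blast
  have "ray_limit h x l" if "h \<in> D" for h
    using D_linked[OF v that] by (induction rule: trancl_induct) (use l step in blast)+
  then have "\<forall>g\<in>D. ray_limit g x l" by blast
  then have "\<forall>g\<in>D. ray_limit g x (b_fin x)" unfolding b_fin_def by (rule someI)
  then show ?thesis using g by blast
qed

lemma b_fin_closed: "x \<in> X_fin \<Longrightarrow> b_fin x \<in> carrier H"
  using ray_limit_b_fin[of x] D_nonempty by (auto simp: ray_limit_def)

text \<open>
  Two finitely supported configurations that agree near \<open>\<one>\<close> are joined by one that differs from
  the first only where the ray of \<open>v\<close> is far away, and from the second only where that of \<open>inv v\<close> is.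
\<close>

lemma b_fin_holder:
  "\<exists>C r. 0 < C \<and> 0 < r \<and> r < (1::real) \<and> (\<forall>x\<in>X_fin. \<forall>y\<in>X_fin. \<forall>m.
    (\<forall>k\<in>carrier G. x k \<noteq> y k \<longrightarrow> m \<le> len k) \<longrightarrow> d (b_fin x) (b_fin y) \<le> C * r ^ m)"
proof -
  obtain v where v: "v \<in> D" using D_nonempty by blast
  have vG: "v \<in> carrier G" "inv v \<in> carrier G" and iv: "inv v \<in> D" using v D_carrier D_inv by auto
  obtain \<xi> where \<xi>: "\<xi> \<in> hom G integer_group" "\<xi> v = 1" using D_hom[OF v] by blast
  obtain K :: nat where K: "0 < K"
    and away: "\<And>k. k \<in> carrier G \<Longrightarrow> (\<forall>n. len k + n \<le> K * len (v [^] n \<otimes> k)) \<or>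
      (\<forall>n. len k + n \<le> K * len (inv v [^] n \<otimes> k))"
    using ray_away[OF \<xi> vG(1)] by metis
  obtain C r where C: "0 < C" "0 < r" "r < (1::real)"
    and fwd: "\<forall>x\<in>X. \<forall>y\<in>X. \<forall>l l' m. ray_limit v x l \<longrightarrow> ray_limit v y l' \<longrightarrow>
      (\<forall>k\<in>carrier G. x k \<noteq> y k \<longrightarrow> (\<forall>n. m + n \<le> K * len (v [^] n \<otimes> k))) \<longrightarrow> d l l' \<le> C * r ^ m"
    using ray_limit_close[OF vG(1) K] by blast
  obtain C' r' where C': "0 < C'" "0 < r'" "r' < (1::real)"
    and bwd: "\<forall>x\<in>X. \<forall>y\<in>X. \<forall>l l' m. ray_limit (inv v) x l \<longrightarrow> ray_limit (inv v) y l' \<longrightarrow>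
      (\<forall>k\<in>carrier G. x k \<noteq> y k \<longrightarrow> (\<forall>n. m + n \<le> K * len (inv v [^] n \<otimes> k))) \<longrightarrow> d l l' \<le> C' * r' ^ m"
    using ray_limit_close[OF vG(2) K] by blast
  have "d (b_fin x) (b_fin y) \<le> (C + C') * max r r' ^ m"
    if x: "x \<in> X_fin" and y: "y \<in> X_fin" and m: "\<forall>k\<in>carrier G. x k \<noteq> y k \<longrightarrow> m \<le> len k" for x y m
  proof -
    define z where "z k = (if \<forall>n. len k + n \<le> K * len (v [^] n \<otimes> k) then y k else x k)" for k
    have "z \<in> X" using x y by (auto simp: X_fin_def full_shift_def PiE_iff extensional_def z_def)
    moreover have "finite {k \<in> carrier G. z k \<noteq> a\<^sub>0}"
    proof (rule finite_subset)
      show "{k \<in> carrier G. z k \<noteq> a\<^sub>0} \<subseteq> {k \<in> carrier G. x k \<noteq> a\<^sub>0} \<union> {k \<in> carrier G. y k \<noteq> a\<^sub>0}"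
        by (auto simp: z_def split: if_splits)
    qed (use x y in \<open>simp add: X_fin_def\<close>)
    ultimately have z: "z \<in> X_fin" by (simp add: X_fin_def)
    have "d (b_fin x) (b_fin z) \<le> C * r ^ m"
    proof (rule fwd[rule_format])
      fix k n assume "k \<in> carrier G" "x k \<noteq> z k"
      then show "m + n \<le> K * len (v [^] n \<otimes> k)"
        using m by (auto simp: z_def split: if_splits intro: order_trans[OF add_right_mono])
    qed (use x z v in \<open>simp_all add: X_fin_X ray_limit_b_fin\<close>)
    \<comment> \<open>The value at z, just reached along the ray of v, is now read along that of
      \<open>inv v\<close>: here both rays must have the same limit.\<close>
    moreover have "d (b_fin z) (b_fin y) \<le> C' * r' ^ m"
    proof (rule bwd[rule_format])
      fix k n assume k: "k \<in> carrier G" "z k \<noteq> y k"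
      then have "len k + n \<le> K * len (inv v [^] n \<otimes> k)" "m \<le> len k"
        using away[of k] m by (auto simp: z_def split: if_splits)
      then show "m + n \<le> K * len (inv v [^] n \<otimes> k)" by linarith
    qed (use y z iv in \<open>simp_all add: X_fin_X ray_limit_b_fin\<close>)
    moreover have "C * r ^ m \<le> C * max r r' ^ m" "C' * r' ^ m \<le> C' * max r r' ^ m"
      using C C' by (auto intro!: mult_left_mono power_mono)
    ultimately show ?thesis
      using M.triangle[of "b_fin x" "b_fin z" "b_fin y"] x y z by (simp add: b_fin_closed distrib_right)
  qed
  then show ?thesis
    using C C' by (intro exI[of _ "C + C'"] exI[of _ "max r r'"]) (auto simp: less_max_iff_disj)
qed

lemma b_fin_equivariant:
  assumes "g \<in> D" "x \<in> X_fin"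
  shows "b_fin (act g x) \<otimes>\<^bsub>H\<^esub> c g x = \<phi> g \<otimes>\<^bsub>H\<^esub> b_fin x"
  using assms D_carrier
  by (intro ray_limit_equivariant ray_limit_b_fin) (auto simp: act_X_fin X_fin_X)

section \<open>Extension from finitely supported configurations to the whole shift\<close>

definition trunc :: "_ \<Rightarrow> nat \<Rightarrow> _" where
  "trunc x n = (\<lambda>k\<in>carrier G. if len k \<le> n then x k else a\<^sub>0)"

lemma trunc_X_fin:
  assumes "x \<in> X"
  shows "trunc x n \<in> X_fin"
proof -
  have "{k \<in> carrier G. trunc x n k \<noteq> a\<^sub>0} \<subseteq> {k \<in> carrier G. len k \<le> n}"
    by (auto simp: trunc_def split: if_splits)
  then have "finite {k \<in> carrier G. trunc x n k \<noteq> a\<^sub>0}"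
    using finite_word_ball finite_subset by blast
  moreover have "trunc x n \<in> X"
    using assms base_letter by (auto simp: trunc_def full_shift_def)
  ultimately show ?thesis by (simp add: X_fin_def)
qed

definition b where
  "b x = (SOME l. l \<in> carrier H \<and> (\<lambda>n. d (b_fin (trunc x n)) l) \<longlonglongrightarrow> 0)"

lemma b_limit:
  assumes x: "x \<in> X"
  shows "b x \<in> carrier H" "(\<lambda>n. d (b_fin (trunc x n)) (b x)) \<longlonglongrightarrow> 0"
proof -
  obtain C r where C: "0 < C" "0 < r" "r < (1::real)"
    and bound: "\<forall>x\<in>X_fin. \<forall>y\<in>X_fin. \<forall>m.
      (\<forall>k\<in>carrier G. x k \<noteq> y k \<longrightarrow> m \<le> len k) \<longrightarrow> d (b_fin x) (b_fin y) \<le> C * r ^ m"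
    using b_fin_holder by blast
  have step: "d (b_fin (trunc x n)) (b_fin (trunc x (Suc n))) \<le> C * r ^ n" for n
    by (intro bound[rule_format] trunc_X_fin x) (auto simp: trunc_def split: if_splits)
  have "\<exists>l. l \<in> carrier H \<and> (\<lambda>n. d (b_fin (trunc x n)) l) \<longlonglongrightarrow> 0"
    using M.geometric_increments_convergent[OF complete _ step C(2,3)] C(1) x
    by (metis b_fin_closed trunc_X_fin less_imp_le)
  from someI_ex[OF this] show "b x \<in> carrier H" "(\<lambda>n. d (b_fin (trunc x n)) (b x)) \<longlonglongrightarrow> 0"
    by (simp_all add: b_def)
qed

text \<open>Both estimates are limits of \<open>b_fin_holder\<close>. The mixed one allows
  \<open>b\<close> to be approximated by \<open>b_fin\<close> at configurations other than the
  truncations that define it, such as translates of truncations in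
  \<open>b_equivariant_D\<close>.\<close>

lemma b_fin_b_holder:
  "\<exists>C r. 0 < C \<and> 0 < r \<and> r < (1::real) \<and>
    (\<forall>x\<in>X_fin. \<forall>y\<in>X. \<forall>m. (\<forall>k\<in>carrier G. x k \<noteq> y k \<longrightarrow> m \<le> len k) \<longrightarrow>
      d (b_fin x) (b y) \<le> C * r ^ m) \<and>
    (\<forall>x\<in>X. \<forall>y\<in>X. \<forall>m. (\<forall>k\<in>carrier G. x k \<noteq> y k \<longrightarrow> m \<le> len k) \<longrightarrow>
      d (b x) (b y) \<le> C * r ^ m)"
proof -
  obtain C r where C: "0 < C" "0 < r" "r < (1::real)"
    and bound: "\<forall>x\<in>X_fin. \<forall>y\<in>X_fin. \<forall>m.
      (\<forall>k\<in>carrier G. x k \<noteq> y k \<longrightarrow> m \<le> len k) \<longrightarrow> d (b_fin x) (b_fin y) \<le> C * r ^ m"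
    using b_fin_holder by blast
  have "d (b_fin x) (b y) \<le> C * r ^ m"
    if x: "x \<in> X_fin" and y: "y \<in> X" and m: "\<forall>k\<in>carrier G. x k \<noteq> y k \<longrightarrow> m \<le> len k" for x y m
  proof (rule dist_limit_le)
    \<comment> \<open>Outside the truncation radius x may differ from \<open>a\<^sub>0\<close>, so
      the radius has to be at least m.\<close>
    show "(\<lambda>n. d (b_fin (trunc y (n + m))) (b y)) \<longlonglongrightarrow> 0"
      using b_limit(2)[OF y] by (rule LIMSEQ_ignore_initial_segment)
    show "(\<lambda>n. d (b_fin x) (b_fin x)) \<longlonglongrightarrow> 0" using x by (simp add: b_fin_closed)
    show "(\<lambda>n::nat. C * r ^ m) \<longlonglongrightarrow> C * r ^ m" by (rule tendsto_const)
    show "d (b_fin x) (b_fin (trunc y (n + m))) \<le> C * r ^ m" for n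
      by (intro bound[rule_format] trunc_X_fin x y) (use m in \<open>auto simp: trunc_def split: if_splits\<close>)
  qed (use x y in \<open>simp_all add: b_fin_closed trunc_X_fin b_limit\<close>)
  moreover have "d (b x) (b y) \<le> C * r ^ m"
    if x: "x \<in> X" and y: "y \<in> X" and m: "\<forall>k\<in>carrier G. x k \<noteq> y k \<longrightarrow> m \<le> len k" for x y m
  proof (rule dist_limit_le)
    show "(\<lambda>n. d (b_fin (trunc x n)) (b x)) \<longlonglongrightarrow> 0" "(\<lambda>n. d (b_fin (trunc y n)) (b y)) \<longlonglongrightarrow> 0"
      using b_limit(2) x y by auto
    show "(\<lambda>n::nat. C * r ^ m) \<longlonglongrightarrow> C * r ^ m" by (rule tendsto_const)
    show "d (b_fin (trunc x n)) (b_fin (trunc y n)) \<le> C * r ^ m" for n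
      by (intro bound[rule_format] trunc_X_fin x y) (use m in \<open>auto simp: trunc_def split: if_splits\<close>)
  qed (use x y in \<open>simp_all add: b_fin_closed trunc_X_fin b_limit\<close>)
  ultimately show ?thesis using C by blast
qed

lemma b_equivariant_D:
  assumes g: "g \<in> D" and x: "x \<in> X"
  shows "b (act g x) \<otimes>\<^bsub>H\<^esub> c g x = \<phi> g \<otimes>\<^bsub>H\<^esub> b x"
proof -
  have gG: "g \<in> carrier G" using g D_carrier by blast
  obtain C r where C: "0 < C" "0 < r" "r < (1::real)"
    and bound: "\<forall>x\<in>X_fin. \<forall>y\<in>X. \<forall>m. (\<forall>k\<in>carrier G. x k \<noteq> y k \<longrightarrow> m \<le> len k) \<longrightarrow>
      d (b_fin x) (b y) \<le> C * r ^ m"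
    using b_fin_b_holder by blast
  obtain C' r' where C': "0 < C'" "0 < r'" "r' < (1::real)"
    and bound': "\<forall>s\<in>{g}. \<forall>x\<in>X. \<forall>y\<in>X. \<forall>m. (\<forall>k\<in>carrier G. x k \<noteq> y k \<longrightarrow> m \<le> 1 * len k) \<longrightarrow>
      d (c s x) (c s y) \<le> C' * r' ^ m"
    using holder_uniform[of "{g}" 1] gG by (simp del: ball_simps) blast
  \<comment> \<open>Translation by g brings a point closer to \<one> by at most
    \<open>len g\<close>; the larger radius makes up for this.\<close>
  define t where "t n = trunc x (n + len g)" for n
  have t: "t n \<in> X_fin" "t n \<in> X" "act g (t n) \<in> X_fin" for n
    using x gG by (simp_all add: t_def trunc_X_fin X_fin_X act_X_fin)
  have t_far: "n + len g \<le> len k" if "k \<in> carrier G" "t n k \<noteq> x k" for k n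
    using that by (auto simp: t_def trunc_def split: if_splits)
  have 1: "d (b_fin (act g (t n))) (b (act g x)) \<le> C * r ^ n" for n
  proof (intro bound[rule_format] t)
    fix h assume h: "h \<in> carrier G" "act g (t n) h \<noteq> act g x h"
    then obtain k where k: "k \<in> carrier G" "t n k \<noteq> x k" "h = g \<otimes> k"
      using shift_action_disagree[OF gG] by metis
    have "k = inv g \<otimes> h" using k gG by (simp add: m_assoc[symmetric])
    then have "len k \<le> len g + len h" using len_mult[of "inv g" h] gG h by (simp add: len_inv)
    then show "n \<le> len h" using t_far[OF k(1,2)] by simp
  qed (use x gG in \<open>simp add: shift_action_closed\<close>)
  have 2: "d (c g (t n)) (c g x) \<le> C' * r' ^ n" for n
  proof (intro bound'[rule_format] t x)
    fix k assume "k \<in> carrier G" "t n k \<noteq> x k"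
    then show "n \<le> 1 * len k" using t_far[of k n] by simp
  qed simp
  have in_H: "c g x \<in> carrier H" "\<phi> g \<in> carrier H" "b x \<in> carrier H" "b (act g x) \<in> carrier H"
      "c g (t n) \<in> carrier H" "b_fin (t n) \<in> carrier H" "b_fin (act g (t n)) \<in> carrier H" for n
    using x gG t by (simp_all add: c_closed \<phi>_closed b_limit b_fin_closed shift_action_closed)
  have "d (b (act g x) \<otimes>\<^bsub>H\<^esub> c g x) (\<phi> g \<otimes>\<^bsub>H\<^esub> b x) \<le> 0"
  proof (rule dist_limit_le)
    let ?u = "\<lambda>n. b_fin (act g (t n)) \<otimes>\<^bsub>H\<^esub> c g (t n)"
    have le: "d (?u n) (b (act g x) \<otimes>\<^bsub>H\<^esub> c g x) \<le> C * r ^ n + C' * r' ^ n" for n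
      using dist_mult_le[OF in_H(7)[of n] in_H(5)[of n] in_H(4) in_H(1)] 1[of n] 2[of n] by linarith
    have majorant: "(\<lambda>n. C * r ^ n + C' * r' ^ n) \<longlonglongrightarrow> 0"
      using C C' by (intro tendsto_add_zero tendsto_mult_right_zero LIMSEQ_realpow_zero) auto
    show "(\<lambda>n. d (?u n) (b (act g x) \<otimes>\<^bsub>H\<^esub> c g x)) \<longlonglongrightarrow> 0"
      by (rule tendsto_sandwich[OF _ _ tendsto_const majorant]) (use le in simp_all)
    have "(\<lambda>n. d (b_fin (t n)) (b x)) \<longlonglongrightarrow> 0"
      unfolding t_def using b_limit(2)[OF x] by (rule LIMSEQ_ignore_initial_segment)
    then show "(\<lambda>n. d (\<phi> g \<otimes>\<^bsub>H\<^esub> b_fin (t n)) (\<phi> g \<otimes>\<^bsub>H\<^esub> b x)) \<longlonglongrightarrow> 0"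
      using in_H by (simp add: left_invariant)
    show "d (?u n) (\<phi> g \<otimes>\<^bsub>H\<^esub> b_fin (t n)) \<le> 0" for n
      using in_H t g by (simp add: b_fin_equivariant)
  qed (use in_H in simp_all)
  then show ?thesis using in_H by (intro eq_if_dist_le_0) auto
qed

text \<open>The ray argument covers only elements of \<open>D\<close>. The cocycle identity and the
  multiplicativity of \<phi> carry the relation over to products.\<close>

lemma b_equivariant:
  assumes "g \<in> carrier G" "x \<in> X"
  shows "b (act g x) \<otimes>\<^bsub>H\<^esub> c g x = \<phi> g \<otimes>\<^bsub>H\<^esub> b x"
  using assms unfolding D_generate[symmetric]
proof (induction g arbitrary: x rule: generate.induct)
  case one
  have "\<phi> \<one> = \<one>\<^bsub>H\<^esub>" "c \<one> x = \<one>\<^bsub>H\<^esub>"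
    using c_mult[of \<one> \<one>] c_closed[of \<one>] one base_in
    by (simp_all add: \<phi>_def shift_action_one)
  then show ?case using one b_limit(1) by (simp add: shift_action_one)
next
  case (incl h)
  then show ?case by (simp add: b_equivariant_D)
next
  case (inv h)
  then show ?case by (simp add: b_equivariant_D D_inv)
next
  case (eng g h)
  have gh: "g \<in> carrier G" "h \<in> carrier G" using eng.hyps D_generate by auto
  have hx: "act h x \<in> X" using gh eng.prems by (simp add: shift_action_closed)
  have ghx: "act g (act h x) \<in> X" using gh hx by (simp add: shift_action_closed)
  note in_H = b_limit(1)[OF ghx] b_limit(1)[OF hx] b_limit(1)[OF eng.prems] \<phi>_closed[OF gh(1)]
    \<phi>_closed[OF gh(2)] c_closed[OF gh(1) hx] c_closed[OF gh(2) eng.prems]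
  have "b (act (g \<otimes> h) x) \<otimes>\<^bsub>H\<^esub> c (g \<otimes> h) x
      = (b (act g (act h x)) \<otimes>\<^bsub>H\<^esub> c g (act h x)) \<otimes>\<^bsub>H\<^esub> c h x"
    using gh eng.prems in_H by (simp add: shift_action_mult c_mult H.m_assoc)
  also have "\<dots> = \<phi> g \<otimes>\<^bsub>H\<^esub> (b (act h x) \<otimes>\<^bsub>H\<^esub> c h x)"
    using eng.IH(1)[OF hx] in_H by (simp add: H.m_assoc)
  also have "\<dots> = \<phi> (g \<otimes> h) \<otimes>\<^bsub>H\<^esub> b x"
    using eng.IH(2)[OF eng.prems] in_H gh by (simp add: \<phi>_mult H.m_assoc)
  finally show ?case .
qed

lemma cohomologous_to_\<phi>: "holder_cohomologous G S A H d c (\<lambda>g x. \<phi> g)"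
proof -
  obtain C r where C: "0 < C" "0 < r" "r < (1::real)"
    and bound: "\<forall>x\<in>X. \<forall>y\<in>X. \<forall>m. (\<forall>k\<in>carrier G. x k \<noteq> y k \<longrightarrow> m \<le> len k) \<longrightarrow>
      d (b x) (b y) \<le> C * r ^ m"
    using b_fin_b_holder by blast
  have "d (b x) (b y) \<le> C * r ^ n" if "x \<in> X" "y \<in> X"
    "restrict x (word_ball G S n) = restrict y (word_ball G S n)" for x y n
    using that bound restrict_word_ball_eqD[OF that(3)] by (meson less_imp_le)
  then have "holder_continuous G S A H d b"
    unfolding holder_continuous_def using C b_limit(1) by blast
  moreover have "c g x = inv\<^bsub>H\<^esub> (b (act g x)) \<otimes>\<^bsub>H\<^esub> \<phi> g \<otimes>\<^bsub>H\<^esub> b x"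
    if g: "g \<in> carrier G" and x: "x \<in> X" for g x
  proof -
    have in_H: "b (act g x) \<in> carrier H" "c g x \<in> carrier H" "\<phi> g \<in> carrier H" "b x \<in> carrier H"
      using g x by (simp_all add: b_limit c_closed \<phi>_closed shift_action_closed)
    have "inv\<^bsub>H\<^esub> (b (act g x)) \<otimes>\<^bsub>H\<^esub> (b (act g x) \<otimes>\<^bsub>H\<^esub> c g x) = c g x"
      using in_H by (simp add: H.m_assoc[symmetric])
    then show ?thesis using b_equivariant[OF g x] in_H by (simp add: H.m_assoc)
  qed
  ultimately show ?thesis unfolding holder_cohomologous_def by blast
qed

end

text \<open>\<open>D\<close> supplies the rays and witnesses that a finite symmetric generating set
  exists; lengths are measured in an arbitrary \<open>S\<close>, unrelated to
  \<open>D\<close>.\<close>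

theorem class_G_H_if_linked:
  fixes G :: "('g, 'm) monoid_scheme"
  assumes "group G" and "finite D" and D: "D \<subseteq> carrier G" "D \<noteq> {}"
    and inv: "\<And>g. g \<in> D \<Longrightarrow> inv\<^bsub>G\<^esub> g \<in> D" and gen: "generate G D = carrier G"
    and linked: "\<And>g h. g \<in> D \<Longrightarrow> h \<in> D \<Longrightarrow> (g, h) \<in> (linked G D)\<^sup>+"
  shows "class_G_H TYPE('a) TYPE('h) G"
proof -
  have "symmetric_generating_set G D"
    using assms by (auto simp: symmetric_generating_set_def)
  moreover have "\<exists>\<phi>\<in>hom G H. holder_cohomologous G S A H d c (\<lambda>g x. \<phi> g)"
    if S: "symmetric_generating_set G S" and A: "finite A" and H: "class_G_inv H T"
      and met: "compatible_bi_invariant_metric H T d" and compl: "Metric_space.mcomplete (carrier H) d"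
      and c: "holder_cocycle G S A H d c"
    for S and A :: "'a set" and H :: "'h monoid" and T d c
  \<comment> \<open>Without a letter there is no \<open>base\<close>; but then the shift is empty
    and the trivial homomorphism works vacuously.\<close>
  proof (cases "A = {}")
    case True
    interpret G: group G by fact
    interpret H: group H using H by (simp add: class_G_inv_def polish_group_def)
    have "full_shift G A = {}"
      using True G.one_closed by (auto simp: full_shift_def PiE_eq_empty_iff)
    then have "holder_cohomologous G S A H d c (\<lambda>g x. \<one>\<^bsub>H\<^esub>)"
      by (auto simp: holder_cohomologous_def holder_continuous_def intro!: exI[of _ 1] exI[of _ "1/2"])
    moreover have "(\<lambda>g. \<one>\<^bsub>H\<^esub>) \<in> hom G H" by (simp add: hom_def)
    ultimately show ?thesis by (rule bexI[where x = "\<lambda>g. \<one>\<^bsub>H\<^esub>"])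
  next
    case False
    then obtain a\<^sub>0 where a\<^sub>0: "a\<^sub>0 \<in> A" by blast
    interpret linked_holder_cocycle G S H d A c a\<^sub>0 D
    proof (intro linked_holder_cocycle.intro holder_cocycle_on_shift.intro word_metric.intro
        word_metric_axioms.intro holder_cocycle_on_shift_axioms.intro linked_holder_cocycle_axioms.intro)
      show "group H" using H by (simp add: class_G_inv_def polish_group_def)
      show "Metric_space (carrier H) d" using met by (simp add: compatible_bi_invariant_metric_def)
    qed (use assms S A a\<^sub>0 compl c met in \<open>auto simp: compatible_bi_invariant_metric_def\<close>)
    show ?thesis using \<phi>_hom cohomologous_to_\<phi> by blast
  qed
  ultimately show ?thesis unfolding class_G_H_def using \<open>group G\<close> by blast
qed

section \<open>Right-angled Artin groups\<close>

definition exponent_sum :: "('v \<Rightarrow> int) \<Rightarrow> 'v word \<Rightarrow> int" where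
  "exponent_sum f u = (\<Sum>(v, b)\<leftarrow>u. if b then f v else - f v)"

lemma exponent_sum_simps [simp]:
  "exponent_sum f [] = 0"
  "exponent_sum f ((v, b) # u) = (if b then f v else - f v) + exponent_sum f u"
  "exponent_sum f (u @ w) = exponent_sum f u + exponent_sum f w"
  by (simp_all add: exponent_sum_def)

lemma exponent_sum_pres_rel:
  assumes "(u, w) \<in> pres_rel X R"
    and "\<And>l r. (l, r) \<in> R \<Longrightarrow> exponent_sum f l = exponent_sum f r"
  shows "exponent_sum f u = exponent_sum f w"
  using assms by (induction rule: pres_rel.induct) auto

lemma carrier_presented_group:
  "carrier (presented_group X R) = {pres_rel X R `` {u} | u. u \<in> words X}"
  by (auto simp: presented_group_def quotient_def)

lemma one_presented_group: "\<one>\<^bsub>presented_group X R\<^esub> = pres_rel X R `` {[]}"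
  by (simp add: presented_group_def)

lemma presented_group_hom_exists:
  assumes "\<And>l r. (l, r) \<in> R \<Longrightarrow> exponent_sum f l = exponent_sum f r"
  obtains \<xi> where "\<xi> \<in> hom (presented_group X R) integer_group"
    "\<And>u. u \<in> words X \<Longrightarrow> \<xi> (pres_rel X R `` {u}) = exponent_sum f u"
proof -
  define \<xi> where "\<xi> P = exponent_sum f (SOME u. u \<in> P)" for P
  have val: "\<xi> (pres_rel X R `` {u}) = exponent_sum f u" if u: "u \<in> words X" for u
  proof -
    have "u \<in> pres_rel X R `` {u}" using u by (auto intro: pres_rel.refl)
    then have "(SOME w. w \<in> pres_rel X R `` {u}) \<in> pres_rel X R `` {u}" by (rule someI)
    then show ?thesis using exponent_sum_pres_rel[OF _ assms] unfolding \<xi>_def by fastforce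
  qed
  have "\<xi> \<in> hom (presented_group X R) integer_group"
    by (rule homI) (auto simp: carrier_presented_group presented_group_mult_class val)
  then show ?thesis using val that by blast
qed

section \<open>Generators of the right-angled Artin group and their inverses\<close>

definition letter :: "'v pair_pre_digraph \<Rightarrow> 'v \<times> bool \<Rightarrow> 'v word set" where
  "letter \<Gamma> a = pres_rel (pverts \<Gamma>)
    {([(v, True), (w, True)], [(w, True), (v, True)]) | v w. (v, w) \<in> parcs \<Gamma>} `` {[a]}"

definition raag_letters :: "'v pair_pre_digraph \<Rightarrow> 'v word set set" where
  "raag_letters \<Gamma> = letter \<Gamma> ` (pverts \<Gamma> \<times> UNIV)"

lemma group_raag: "group (raag \<Gamma>)"
  unfolding raag_def by (rule group_presented_group)

lemma letter_closed: "v \<in> pverts \<Gamma> \<Longrightarrow> letter \<Gamma> (v, b) \<in> carrier (raag \<Gamma>)"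
  by (force simp: raag_def letter_def carrier_presented_group)

lemma letter_inverse:
  assumes "v \<in> pverts \<Gamma>"
  shows "inv\<^bsub>raag \<Gamma>\<^esub> letter \<Gamma> (v, b) = letter \<Gamma> (v, \<not> b)"
proof -
  interpret group "raag \<Gamma>" by (rule group_raag)
  let ?R = "{([(v, True), (w, True)], [(w, True), (v, True)]) | v w. (v, w) \<in> parcs \<Gamma>}"
  have "([(v, \<not> b), (v, \<not> \<not> b)], []) \<in> pres_rel (pverts \<Gamma>) ?R"
    using pres_rel.cancel[of "[]" "pverts \<Gamma>" "[]" v "\<not> b" ?R] assms by simp
  then have "letter \<Gamma> (v, \<not> b) \<otimes>\<^bsub>raag \<Gamma>\<^esub> letter \<Gamma> (v, b) = \<one>\<^bsub>raag \<Gamma>\<^esub>"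
    using assms equiv_class_eq[OF equiv_pres_rel, of _ _ "pverts \<Gamma>" ?R]
    by (simp add: raag_def letter_def presented_group_mult_class one_presented_group)
  then show ?thesis using assms by (intro inv_equality letter_closed)
qed

lemma letters_commute:
  assumes "(v, w) \<in> parcs \<Gamma>" "v \<in> pverts \<Gamma>" "w \<in> pverts \<Gamma>"
  shows "letter \<Gamma> (v, b) \<otimes>\<^bsub>raag \<Gamma>\<^esub> letter \<Gamma> (w, b') = letter \<Gamma> (w, b') \<otimes>\<^bsub>raag \<Gamma>\<^esub> letter \<Gamma> (v, b)"
proof -
  interpret group "raag \<Gamma>" by (rule group_raag)
  let ?R = "{([(v, True), (w, True)], [(w, True), (v, True)]) | v w. (v, w) \<in> parcs \<Gamma>}"
  have "([(v, True), (w, True)], [(w, True), (v, True)]) \<in> pres_rel (pverts \<Gamma>) ?R"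
    using pres_rel.relation[of "[]" "pverts \<Gamma>" "[]" "[(v, True), (w, True)]" "[(w, True), (v, True)]" ?R]
      assms by auto
  then have pos: "letter \<Gamma> (v, True) \<otimes>\<^bsub>raag \<Gamma>\<^esub> letter \<Gamma> (w, True)
      = letter \<Gamma> (w, True) \<otimes>\<^bsub>raag \<Gamma>\<^esub> letter \<Gamma> (v, True)"
    using assms equiv_class_eq[OF equiv_pres_rel, of _ _ "pverts \<Gamma>" ?R]
    by (simp add: raag_def letter_def presented_group_mult_class)
  \<comment> \<open>Used once for each factor, to pass from the defining relation to all four
    choices of signs.\<close>
  have inv_comm: "inv\<^bsub>raag \<Gamma>\<^esub> x \<otimes>\<^bsub>raag \<Gamma>\<^esub> y = y \<otimes>\<^bsub>raag \<Gamma>\<^esub> inv\<^bsub>raag \<Gamma>\<^esub> x"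
    if "x \<otimes>\<^bsub>raag \<Gamma>\<^esub> y = y \<otimes>\<^bsub>raag \<Gamma>\<^esub> x" "x \<in> carrier (raag \<Gamma>)" "y \<in> carrier (raag \<Gamma>)" for x y
    using that by (metis inv_closed inv_solve_left inv_solve_right m_assoc m_closed)
  have neg: "letter \<Gamma> (v, b) \<otimes>\<^bsub>raag \<Gamma>\<^esub> letter \<Gamma> (w, True)
      = letter \<Gamma> (w, True) \<otimes>\<^bsub>raag \<Gamma>\<^esub> letter \<Gamma> (v, b)"
    using pos inv_comm[OF pos] assms by (cases b) (simp_all add: letter_closed letter_inverse)
  show ?thesis
    using neg inv_comm[OF neg[symmetric]] assms
    by (cases b') (simp_all add: letter_closed letter_inverse)
qed

text \<open>Both sides of a commutation relation contain the same letters, so arbitrary integer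
  weights on the vertices respect the relations.\<close>

lemma raag_hom_exists:
  obtains \<xi> where "\<xi> \<in> hom (raag \<Gamma>) integer_group"
    "\<And>v b. v \<in> pverts \<Gamma> \<Longrightarrow> \<xi> (letter \<Gamma> (v, b)) = (if b then f v else - f v)"
proof -
  let ?R = "{([(v, True), (w, True)], [(w, True), (v, True)]) | v w. (v, w) \<in> parcs \<Gamma>}"
  have "exponent_sum f l = exponent_sum f r" if "(l, r) \<in> ?R" for l r
    using that by auto
  then obtain \<xi> where "\<xi> \<in> hom (presented_group (pverts \<Gamma>) ?R) integer_group"
      "\<And>u. u \<in> words (pverts \<Gamma>) \<Longrightarrow> \<xi> (pres_rel (pverts \<Gamma>) ?R `` {u}) = exponent_sum f u"
    using presented_group_hom_exists[of ?R f "pverts \<Gamma>"] by blast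
  then show ?thesis by (intro that[of \<xi>]) (simp_all add: raag_def letter_def)
qed

lemma generate_raag_letters: "generate (raag \<Gamma>) (raag_letters \<Gamma>) = carrier (raag \<Gamma>)"
proof
  interpret group "raag \<Gamma>" by (rule group_raag)
  show "generate (raag \<Gamma>) (raag_letters \<Gamma>) \<subseteq> carrier (raag \<Gamma>)"
    by (rule generate_incl) (auto simp: raag_letters_def letter_closed)
  let ?R = "{([(v, True), (w, True)], [(w, True), (v, True)]) | v w. (v, w) \<in> parcs \<Gamma>}"
  have "pres_rel (pverts \<Gamma>) ?R `` {u} \<in> generate (raag \<Gamma>) (raag_letters \<Gamma>)"
    if "u \<in> words (pverts \<Gamma>)" for u
    using that
  proof (induction u)
    case Nil
    then show ?case
      using generate.one[of "raag \<Gamma>"] by (simp add: raag_def one_presented_group)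
  next
    case (Cons a u)
    have "pres_rel (pverts \<Gamma>) ?R `` {a # u} = letter \<Gamma> a \<otimes>\<^bsub>raag \<Gamma>\<^esub> (pres_rel (pverts \<Gamma>) ?R `` {u})"
      using Cons.prems presented_group_mult_class[of "[a]" "pverts \<Gamma>" u ?R]
      by (simp add: raag_def letter_def)
    moreover have "letter \<Gamma> a \<in> raag_letters \<Gamma>"
      using Cons.prems by (cases a) (auto simp: raag_letters_def)
    ultimately show ?case using Cons by (simp add: generate.eng generate.incl)
  qed
  then show "carrier (raag \<Gamma>) \<subseteq> generate (raag \<Gamma>) (raag_letters \<Gamma>)"
    by (auto simp: raag_def carrier_presented_group)
qed

lemma adjacent_letters_linked:
  assumes adj: "(v, w) \<in> parcs \<Gamma>" "v \<in> pverts \<Gamma>" "w \<in> pverts \<Gamma>" and "v \<noteq> w"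
  shows "(letter \<Gamma> (v, b), letter \<Gamma> (w, b')) \<in> linked (raag \<Gamma>) (raag_letters \<Gamma>)"
proof -
  \<comment> \<open>The weight of each of the two vertices is the sign of its letter, so both
    letters get the value 1. As v and w are distinct, the two signs can be chosen
    independently.\<close>
  let ?f = "\<lambda>u. if u = v then (if b then 1 else - 1) else if b' then 1 else - 1 :: int"
  obtain \<xi> where \<xi>: "\<xi> \<in> hom (raag \<Gamma>) integer_group"
    and val: "\<And>u b. u \<in> pverts \<Gamma> \<Longrightarrow> \<xi> (letter \<Gamma> (u, b)) = (if b then ?f u else - ?f u)"
    using raag_hom_exists[of \<Gamma> ?f] by metis
  have "\<xi> (letter \<Gamma> (v, b)) = 1" "\<xi> (letter \<Gamma> (w, b')) = 1"
    using assms by (auto simp: val)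
  with \<xi> have "\<exists>\<xi>\<in>hom (raag \<Gamma>) integer_group. \<xi> (letter \<Gamma> (v, b)) = 1 \<and> \<xi> (letter \<Gamma> (w, b')) = 1"
    by blast
  then show ?thesis
    using letters_commute[OF adj] adj by (simp add: linked_def raag_letters_def)
qed

theorem mainTheorem5:
  fixes \<Gamma> :: "'v pair_pre_digraph"
  assumes "pair_graph \<Gamma>"
    and "Digraph_Component.connected (with_proj \<Gamma>)"
    and "card (pverts \<Gamma>) \<ge> 3"
  shows "class_G_H TYPE('a) TYPE('h) (raag \<Gamma>)"
proof (rule class_G_H_if_linked[of _ "raag_letters \<Gamma>"])
  interpret pair_graph \<Gamma> by fact
  have sym: "(w, v) \<in> parcs \<Gamma>" if "(v, w) \<in> parcs \<Gamma>" for v w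
    using pair_sym_arcs that unfolding symmetric_def by (simp add: symD)
  \<comment> \<open>Connectedness is defined through the symmetric closure of the graph, whose arcs
    are already arcs of \<Gamma>.\<close>
  have path: "(v, w) \<in> (parcs \<Gamma>)\<^sup>*" if "v \<in> pverts \<Gamma>" "w \<in> pverts \<Gamma>" for v w
  proof -
    have "v \<rightarrow>\<^sup>*\<^bsub>mk_symmetric \<Gamma>\<^esub> w"
      using assms(2) that by (simp add: connected_def strongly_connected_def)
    then have "(v, w) \<in> (parcs (mk_symmetric \<Gamma>))\<^sup>*"
      unfolding reachable_def by (auto dest: rtrancl_on_rtranclI)
    moreover have "parcs (mk_symmetric \<Gamma>) \<subseteq> parcs \<Gamma>"
      using sym by (auto simp: parcs_mk_symmetric)
    ultimately show ?thesis using rtrancl_mono by blast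
  qed
  \<comment> \<open>The first edge of a path to some other vertex.\<close>
  have neighbour: "\<exists>u. (v, u) \<in> parcs \<Gamma>" if v: "v \<in> pverts \<Gamma>" for v
  proof -
    have "\<not> pverts \<Gamma> \<subseteq> {v}" using assms(3) card_mono[of "{v}" "pverts \<Gamma>"] by auto
    then obtain w where w: "w \<in> pverts \<Gamma>" "w \<noteq> v" by blast
    show ?thesis using path[OF v w(1)] w(2) by (cases rule: converse_rtranclE) auto
  qed
  let ?L = "linked (raag \<Gamma>) (raag_letters \<Gamma>)"
  have edge: "(letter \<Gamma> (v, b), letter \<Gamma> (w, b')) \<in> ?L" if "(v, w) \<in> parcs \<Gamma>" for v w b b'
    using adjacent_letters_linked[OF that in_arcsD1[OF that] in_arcsD2[OF that] no_loops'[OF that]] .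
  \<comment> \<open>A letter and its inverse are never linked directly, as \<xi> takes opposite
    values on them; two links through a letter of the neighbour u join them.\<close>
  have same: "(letter \<Gamma> (v, b), letter \<Gamma> (v, b')) \<in> ?L\<^sup>+" if v: "v \<in> pverts \<Gamma>" for v b b'
  proof -
    obtain u where u: "(v, u) \<in> parcs \<Gamma>" using neighbour[OF v] by blast
    show ?thesis
      by (rule trancl_trans[OF r_into_trancl[OF edge[OF u, of b True]] r_into_trancl[OF edge[OF sym[OF u]]]])
  qed
  have all: "(letter \<Gamma> (v, b), letter \<Gamma> (w, b')) \<in> ?L\<^sup>+" if v: "v \<in> pverts \<Gamma>" and w: "w \<in> pverts \<Gamma>"
    for v w b b'
    using path[OF v w]
  proof (induction arbitrary: b' rule: rtrancl_induct)
    case base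
    show ?case using same[OF v] .
  next
    case (step u w)
    show ?case by (rule trancl_into_trancl[OF step.IH[of True] edge[OF step.hyps(2)]])
  qed
  show "(g, h) \<in> ?L\<^sup>+" if "g \<in> raag_letters \<Gamma>" "h \<in> raag_letters \<Gamma>" for g h
    using that all by (auto simp: raag_letters_def)
  show "finite (raag_letters \<Gamma>)"
    using pair_finite_verts by (simp add: raag_letters_def)
  show "raag_letters \<Gamma> \<noteq> {}"
    using assms(3) by (auto simp: raag_letters_def)
  show "raag_letters \<Gamma> \<subseteq> carrier (raag \<Gamma>)"
    by (auto simp: raag_letters_def letter_closed)
  show "inv\<^bsub>raag \<Gamma>\<^esub> g \<in> raag_letters \<Gamma>" if "g \<in> raag_letters \<Gamma>" for g
    using that by (auto simp: raag_letters_def letter_inverse)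
qed (simp_all add: group_raag generate_raag_letters)

end
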